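(* Let $\Lambda$ be a semiring. Let $E: G \xrightarrow{\varkappa} B \xrightarrow{\sigma} C$ be a Schreier short exact sequence of chain complexes of $\Lambda$-semimodules and their morphisms, where $G=\{G_n,d_n\}$ is an ordinary chain complex (regarded as $\{G_n,d_n,0\}$), $B=\{B_n,\partial_n^+,\partial_n^-\}$, $C=\{C_n,\delta_n^+,\delta_n^-\}$, and each $G_n$ is a $\Lambda$-module. Assume that one of the following conditions holds: (i) $\sigma$ is a $\pm$-morphism; (ii) $C$ is a chain complex of cancellative $\Lambda$-semimodules. Then the long homology sequence $$\cdots\to H_n(G)\xrightarrow{H_n(\varkappa)}H_n(B)\xrightarrow{H_n(\sigma)}H_n(C)\xrightarrow{\partial_n(E)}H_{n-1}(G)\xrightarrow{H_{n-1}(\varkappa)}H_{n-1}(B)\to\cdots$$ (where $\partial_n(E)=\partial_n(K(E))H_n(k_C)$) is, for every $n\in\mathbb{Z}$, exact at $H_n(B)$ and at $H_n(C)$; moreover $\partial_n(E)(H_n(C))\subset\operatorname{Ker}(H_{n-1}(\varkappa))$, and $H_n(\sigma)$ is a normal $\Lambda$-homomorphism. Furthermore, if $\partial_n(K(E))H_n(k_C)(H_n(C))=\partial_n(K(E))(H_n(K(C)))$, then the sequence is exact at $H_{n-1}(G)$. When (ii) holds, the converse of this last implication is also valid.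
   Context: Semimodules. A semiring $\Lambda=(\Lambda,+,0,\cdot,1)$ has $(\Lambda,+,0)$ an abelian monoid, $(\Lambda,\cdot,1)$ a monoid, two-sided distributivity, and $\lambda\cdot 0=0\cdot\lambda=0$. A (left) $\Lambda$-semimodule is an abelian monoid $A$ with an action $\Lambda\times A\to A$ that is additive in each variable, with $(\lambda\lambda')a=\lambda(\lambda' a)$, $1a=a$, $0a=0$. A $\Lambda$-homomorphism is an additive map $f$ with $f(\lambda a)=\lambda f(a)$. $\operatorname{Ker}(f)=\{a: f(a)=0\}$. $A$ is cancellative if $a+a'=a+a''$ implies $a'=a''$; $A$ is a $\Lambda$-module if $(A,+)$ is a group. A sequence $X\xrightarrow{\alpha}Y\xrightarrow{\beta}Z$ of $\Lambda$-homomorphisms is exact (at $Y$) if $\alpha(X)=\operatorname{Ker}(\beta)$. A $\Lambda$-homomorphism $\varphi:A\to B$ is normal if whenever $\varphi(a_1)=\varphi(a_2)$ there are $\kappa_1,\kappa_2\in\operatorname{Ker}(\varphi)$ with $\kappa_1+a_1=\kappa_2+a_2$. Completion. $K(A)$ is the group completion of $A$ (classes $[a_1,a_2]$ of pairs, with $[u,v]=[x,y]$ iff $u+y+z=v+x+z$ for some $z$); it is a module over the ring completion $K(\Lambda)$. $k_A:A\to K(A)$, $k_A(a)=[a,0]$, is the canonical homomorphism, and $K(f)([a_1,a_2])=[f(a_1),f(a_2)]$. If $A$ is a $\Lambda$-module, then $K(A)$ is identified with $A$ via $k_A$. Chain complexes. A chain complex $X=\{X_n,\partial_n^+,\partial_n^-\}_{n\in\mathbb{Z}}$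 consists of $\Lambda$-semimodules $X_n$ and $\Lambda$-homomorphisms $\partial_n^+,\partial_n^-:X_n\to X_{n-1}$ with $\partial_n^+\partial_{n+1}^++\partial_n^-\partial_{n+1}^-=\partial_n^+\partial_{n+1}^-+\partial_n^-\partial_{n+1}^+$ for all $n$. Put $Z_n(X)=\{x\in X_n:\partial_n^+(x)=\partial_n^-(x)\}$ and $H_n(X)=Z_n(X)/\rho_n(X)$, where $x\,\rho_n(X)\,y$ iff $x+\partial_{n+1}^+(u)+\partial_{n+1}^-(v)=y+\partial_{n+1}^+(v)+\partial_{n+1}^-(u)$ for some $u,v\in X_{n+1}$; $\operatorname{cl}(x)$ denotes the class of $x$. An ordinary chain complex $\{C_n,\partial_n\}$ (with $\partial_n\partial_{n+1}=0$) is identified with $\{C_n,\partial_n,0\}$. A morphism $f=\{f_n\}:X\to X'$ is a sequence of $\Lambda$-homomorphisms $f_n:X_n\to X'_n$ with $\partial_n'^+f_n+f_{n-1}\partial_n^-=\partial_n'^-f_n+f_{n-1}\partial_n^+$ for all $n$; it is a $\pm$-morphism if $f_{n-1}\partial_n^+=\partial_n'^+f_n$ and $f_{n-1}\partial_n^-=\partial_n'^-f_n$ for all $n$. Whenever $f_n(Z_n(X))\subset Z_n(X')$ and $\operatorname{cl}(x)\mapsto\operatorname{cl}(f_n(x))$ is well defined, this map is a $\Lambda$-homomorphism denoted $H_n(f):H_n(X)\to H_n(X')$ (in the present setting $H_n(\varkappa)$ and $H_n(\sigma)$ are defined for all $n$). For a chain complex $X$, $K(X)=\{K(X_n),K(\partial_n^+)-K(\partial_n^-)\}$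 is an ordinary chain complex of modules, and for a morphism $f$, $K(f)=\{K(f_n)\}$ is a usual chain map. $H_n(k_X):H_n(X)\to H_n(K(X))$ is the $\Lambda$-homomorphism $\operatorname{cl}(x)\mapsto\operatorname{cl}([x,0])$. When all $G_n$ are modules, $H_n(K(G))=H_n(G)$. Schreier extensions. A sequence $A\xrightarrow{\lambda}B\xrightarrow{\tau}C$ of $\Lambda$-homomorphisms is a Schreier extension of $A$ by $C$ if $\lambda$ is injective, $\tau$ is surjective, $\lambda(A)=\operatorname{Ker}(\tau)$, and for every $c\in C$ the set $\tau^{-1}(c)$ contains an element $u_c$ (called a representative) such that every $b\in\tau^{-1}(c)$ can be written $b=\lambda(a)+u_c$ for a unique $a\in A$. A Schreier short exact sequence of chain complexes $E:A\xrightarrow{\varkappa}B\xrightarrow{\sigma}C$ is a sequence of chain complexes and morphisms such that each $E_n:A_n\xrightarrow{\varkappa_n}B_n\xrightarrow{\sigma_n}C_n$ is a Schreier extension. Then $K(E):0\to K(A)\to K(B)\to K(C)\to0$ is a short exact sequence of ordinary chain complexes of modules, and $\partial_n(K(E)):H_n(K(C))\to H_{n-1}(K(A))$ denotes its usual connecting homomorphism (here $A=G$, so $\partial_n(K(E))$ has values in $H_{n-1}(G)$). *)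

theory Defs
  imports "HOL-Algebra.Module" "HOL-Algebra.AbelCoset"
begin

section \<open>Semimodules over a semiring\<close>

text \<open>
  Semimodules reuse the record type of \<^theory>\<open>HOL-Algebra.Module\<close>, whose multiplicative
  fields are ignored, as in the locale \<^locale>\<open>module\<close>.  Neither \<open>0 \<noteq> 1\<close> nor commutativity of
  the semiring is assumed.
\<close>

locale semimodule = R?: semiring R + M?: abelian_monoid M
  for R (structure) and M (structure) +
  assumes smult_closed:
      "\<lbrakk>a \<in> carrier R; x \<in> carrier M\<rbrakk> \<Longrightarrow> a \<odot>\<^bsub>M\<^esub> x \<in> carrier M"
    and smult_l_distr:
      "\<lbrakk>a \<in> carrier R; b \<in> carrier R; x \<in> carrier M\<rbrakk>
        \<Longrightarrow> (a \<oplus> b) \<odot>\<^bsub>M\<^esub> x = a \<odot>\<^bsub>M\<^esub> x \<oplus>\<^bsub>M\<^esub> b \<odot>\<^bsub>M\<^esub> x"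
    and smult_r_distr:
      "\<lbrakk>a \<in> carrier R; x \<in> carrier M; y \<in> carrier M\<rbrakk>
        \<Longrightarrow> a \<odot>\<^bsub>M\<^esub> (x \<oplus>\<^bsub>M\<^esub> y) = a \<odot>\<^bsub>M\<^esub> x \<oplus>\<^bsub>M\<^esub> a \<odot>\<^bsub>M\<^esub> y"
    and smult_assoc1:
      "\<lbrakk>a \<in> carrier R; b \<in> carrier R; x \<in> carrier M\<rbrakk>
        \<Longrightarrow> (a \<otimes> b) \<odot>\<^bsub>M\<^esub> x = a \<odot>\<^bsub>M\<^esub> (b \<odot>\<^bsub>M\<^esub> x)"
    and smult_one: "x \<in> carrier M \<Longrightarrow> \<one> \<odot>\<^bsub>M\<^esub> x = x"
    and smult_zero: "x \<in> carrier M \<Longrightarrow> \<zero> \<odot>\<^bsub>M\<^esub> x = \<zero>\<^bsub>M\<^esub>"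

text \<open>Preservation of zero is not required explicitly: it follows from \<open>0 a = 0\<close>.\<close>

locale semimodule_hom = A?: semimodule R A + B?: semimodule R B
  for R (structure) and A (structure) and B (structure) +
  fixes f
  assumes hom_closed: "x \<in> carrier A \<Longrightarrow> f x \<in> carrier B"
    and hom_add:
      "\<lbrakk>x \<in> carrier A; y \<in> carrier A\<rbrakk> \<Longrightarrow> f (x \<oplus>\<^bsub>A\<^esub> y) = f x \<oplus>\<^bsub>B\<^esub> f y"
    and hom_smult:
      "\<lbrakk>r \<in> carrier R; x \<in> carrier A\<rbrakk> \<Longrightarrow> f (r \<odot>\<^bsub>A\<^esub> x) = r \<odot>\<^bsub>B\<^esub> f x"

definition cancellative :: "('r, 'a) module \<Rightarrow> bool" where
  "cancellative A \<longleftrightarrow>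
    (\<forall>a\<in>carrier A. \<forall>x\<in>carrier A. \<forall>y\<in>carrier A. a \<oplus>\<^bsub>A\<^esub> x = a \<oplus>\<^bsub>A\<^esub> y \<longrightarrow> x = y)"

definition exact_at ::
  "('r, 'm) ring_scheme \<Rightarrow> ('r, 'a) module \<Rightarrow> ('a \<Rightarrow> 'b) \<Rightarrow> ('r, 'b) module
    \<Rightarrow> ('b \<Rightarrow> 'c) \<Rightarrow> ('r, 'c) module \<Rightarrow> bool" where
  "exact_at R X \<alpha> Y \<beta> Z \<longleftrightarrow>
    semimodule_hom R X Y \<alpha> \<and> semimodule_hom R Y Z \<beta> \<and> \<alpha> ` carrier X = a_kernel Y Z \<beta>"

definition normal_hom ::
  "('r, 'm) ring_scheme \<Rightarrow> ('r, 'a) module \<Rightarrow> ('r, 'b) module \<Rightarrow> ('a \<Rightarrow> 'b) \<Rightarrow> bool" where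
  "normal_hom R A B \<phi> \<longleftrightarrow> semimodule_hom R A B \<phi> \<and>
    (\<forall>a\<^sub>1\<in>carrier A. \<forall>a\<^sub>2\<in>carrier A. \<phi> a\<^sub>1 = \<phi> a\<^sub>2 \<longrightarrow>
      (\<exists>k\<^sub>1\<in>a_kernel A B \<phi>. \<exists>k\<^sub>2\<in>a_kernel A B \<phi>. k\<^sub>1 \<oplus>\<^bsub>A\<^esub> a\<^sub>1 = k\<^sub>2 \<oplus>\<^bsub>A\<^esub> a\<^sub>2))"

definition schreier_extension ::
  "('r, 'm) ring_scheme \<Rightarrow> ('r, 'a) module \<Rightarrow> ('r, 'b) module \<Rightarrow> ('r, 'c) module
    \<Rightarrow> ('a \<Rightarrow> 'b) \<Rightarrow> ('b \<Rightarrow> 'c) \<Rightarrow> bool" where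
  "schreier_extension R A B C l t \<longleftrightarrow>
    semimodule_hom R A B l \<and> semimodule_hom R B C t \<and>
    inj_on l (carrier A) \<and> t ` carrier B = carrier C \<and>
    l ` carrier A = a_kernel B C t \<and>
    (\<forall>c\<in>carrier C. \<exists>u\<in>carrier B. t u = c \<and>
      (\<forall>b\<in>carrier B. t b = c \<longrightarrow> (\<exists>!a. a \<in> carrier A \<and> b = l a \<oplus>\<^bsub>B\<^esub> u)))"


section \<open>Group completion\<close>

definition completion_rel :: "('r, 'a) module \<Rightarrow> (('a \<times> 'a) \<times> ('a \<times> 'a)) set" where
  "completion_rel A = {((u, v), (x, y)).
    u \<in> carrier A \<and> v \<in> carrier A \<and> x \<in> carrier A \<and> y \<in> carrier A \<and>
    (\<exists>z\<in>carrier A. u \<oplus>\<^bsub>A\<^esub> y \<oplus>\<^bsub>A\<^esub> z = v \<oplus>\<^bsub>A\<^esub> x \<oplus>\<^bsub>A\<^esub> z)}"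

definition completion_class :: "('r, 'a) module \<Rightarrow> 'a \<times> 'a \<Rightarrow> ('a \<times> 'a) set" where
  "completion_class A p = completion_rel A `` {p}"

text \<open>
  Here and for homology below, operations on classes are written as the union of the resulting
  classes over all representatives; when the operation is well defined these classes coincide
  (compare \<open>UN_equiv_class\<close> in the theory of equivalence relations).  The completion is
  regarded as a module over the original semiring, that is, its structure over the completed
  ring is restricted along the canonical homomorphism.
\<close>

definition completion :: "('r, 'a) module \<Rightarrow> ('r, ('a \<times> 'a) set) module" where
  "completion A = \<lparr>
    carrier = (carrier A \<times> carrier A) // completion_rel A,
    monoid.mult = undefined,
    one = undefined,
    zero = completion_class A (\<zero>\<^bsub>A\<^esub>, \<zero>\<^bsub>A\<^esub>),
    add = (\<lambda>U V. \<Union>(a\<^sub>1, a\<^sub>2)\<in>U. \<Union>(b\<^sub>1, b\<^sub>2)\<in>V. completion_class A (a\<^sub>1 \<oplus>\<^bsub>A\<^esub> b\<^sub>1, a\<^sub>2 \<oplus>\<^bsub>A\<^esub> b\<^sub>2)),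
    smult = (\<lambda>r U. \<Union>(a\<^sub>1, a\<^sub>2)\<in>U. completion_class A (r \<odot>\<^bsub>A\<^esub> a\<^sub>1, r \<odot>\<^bsub>A\<^esub> a\<^sub>2)) \<rparr>"

definition completion_unit :: "('r, 'a) module \<Rightarrow> 'a \<Rightarrow> ('a \<times> 'a) set" where
  "completion_unit A a = completion_class A (a, \<zero>\<^bsub>A\<^esub>)"

text \<open>The codomain \<open>B\<close> of \<open>f\<close> is needed to form classes.\<close>

definition completion_map ::
  "('r, 'b) module \<Rightarrow> ('a \<Rightarrow> 'b) \<Rightarrow> ('a \<times> 'a) set \<Rightarrow> ('b \<times> 'b) set" where
  "completion_map B f U = (\<Union>(a\<^sub>1, a\<^sub>2)\<in>U. completion_class B (f a\<^sub>1, f a\<^sub>2))"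


section \<open>Chain complexes\<close>

text \<open>
  The semimodules of one complex live in a common type \<open>'a\<close>, with carrier and operations
  depending on the degree; since any family of semimodules embeds in the disjoint union of its
  members, this is no restriction.  The maps in degree \<open>n\<close> go from degree \<open>n\<close> to degree \<open>n - 1\<close>.
\<close>

record ('r, 'a) pm_complex =
  chains :: "int \<Rightarrow> ('r, 'a) module"
  dpos :: "int \<Rightarrow> 'a \<Rightarrow> 'a"
  dneg :: "int \<Rightarrow> 'a \<Rightarrow> 'a"

definition chain_complex :: "('r, 'm) ring_scheme \<Rightarrow> ('r, 'a) pm_complex \<Rightarrow> bool" where
  "chain_complex R X \<longleftrightarrow>
    (\<forall>n. semimodule_hom R (chains X n) (chains X (n - 1)) (dpos X n)) \<and>
    (\<forall>n. semimodule_hom R (chains X n) (chains X (n - 1)) (dneg X n)) \<and>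
    (\<forall>n. \<forall>x\<in>carrier (chains X (n + 1)).
      dpos X n (dpos X (n + 1) x) \<oplus>\<^bsub>chains X (n - 1)\<^esub> dneg X n (dneg X (n + 1) x) =
      dpos X n (dneg X (n + 1) x) \<oplus>\<^bsub>chains X (n - 1)\<^esub> dneg X n (dpos X (n + 1) x))"

definition ordinary_chain_complex ::
  "('r, 'm) ring_scheme \<Rightarrow> (int \<Rightarrow> ('r, 'a) module) \<Rightarrow> (int \<Rightarrow> 'a \<Rightarrow> 'a) \<Rightarrow> bool" where
  "ordinary_chain_complex R C d \<longleftrightarrow>
    (\<forall>n. semimodule_hom R (C n) (C (n - 1)) (d n)) \<and>
    (\<forall>n. \<forall>x\<in>carrier (C (n + 1)). d n (d (n + 1) x) = \<zero>\<^bsub>C (n - 1)\<^esub>)"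

definition ordinary :: "(int \<Rightarrow> ('r, 'a) module) \<Rightarrow> (int \<Rightarrow> 'a \<Rightarrow> 'a) \<Rightarrow> ('r, 'a) pm_complex" where
  "ordinary C d = \<lparr> chains = C, dpos = d, dneg = (\<lambda>n x. \<zero>\<^bsub>C (n - 1)\<^esub>) \<rparr>"

definition chain_morphism ::
  "('r, 'm) ring_scheme \<Rightarrow> ('r, 'a) pm_complex \<Rightarrow> ('r, 'b) pm_complex
    \<Rightarrow> (int \<Rightarrow> 'a \<Rightarrow> 'b) \<Rightarrow> bool" where
  "chain_morphism R X X' f \<longleftrightarrow>
    (\<forall>n. semimodule_hom R (chains X n) (chains X' n) (f n)) \<and>
    (\<forall>n. \<forall>x\<in>carrier (chains X n).
      dpos X' n (f n x) \<oplus>\<^bsub>chains X' (n - 1)\<^esub> f (n - 1) (dneg X n x) =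
      dneg X' n (f n x) \<oplus>\<^bsub>chains X' (n - 1)\<^esub> f (n - 1) (dpos X n x))"

definition pm_morphism ::
  "('r, 'm) ring_scheme \<Rightarrow> ('r, 'a) pm_complex \<Rightarrow> ('r, 'b) pm_complex
    \<Rightarrow> (int \<Rightarrow> 'a \<Rightarrow> 'b) \<Rightarrow> bool" where
  "pm_morphism R X X' f \<longleftrightarrow>
    chain_morphism R X X' f \<and>
    (\<forall>n. \<forall>x\<in>carrier (chains X n).
      f (n - 1) (dpos X n x) = dpos X' n (f n x) \<and>
      f (n - 1) (dneg X n x) = dneg X' n (f n x))"

definition schreier_short_exact ::
  "('r, 'm) ring_scheme \<Rightarrow> ('r, 'a) pm_complex \<Rightarrow> ('r, 'b) pm_complex \<Rightarrow> ('r, 'c) pm_complex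
    \<Rightarrow> (int \<Rightarrow> 'a \<Rightarrow> 'b) \<Rightarrow> (int \<Rightarrow> 'b \<Rightarrow> 'c) \<Rightarrow> bool" where
  "schreier_short_exact R A B C f g \<longleftrightarrow>
    chain_complex R A \<and> chain_complex R B \<and> chain_complex R C \<and>
    chain_morphism R A B f \<and> chain_morphism R B C g \<and>
    (\<forall>n. schreier_extension R (chains A n) (chains B n) (chains C n) (f n) (g n))"


section \<open>Homology\<close>

definition cycles :: "('r, 'a) pm_complex \<Rightarrow> int \<Rightarrow> 'a set" where
  "cycles X n = {x \<in> carrier (chains X n). dpos X n x = dneg X n x}"

definition homology_rel :: "('r, 'a) pm_complex \<Rightarrow> int \<Rightarrow> ('a \<times> 'a) set" where
  "homology_rel X n = {(x, y). x \<in> cycles X n \<and> y \<in> cycles X n \<and>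
    (\<exists>u\<in>carrier (chains X (n + 1)). \<exists>v\<in>carrier (chains X (n + 1)).
      x \<oplus>\<^bsub>chains X n\<^esub> dpos X (n + 1) u \<oplus>\<^bsub>chains X n\<^esub> dneg X (n + 1) v =
      y \<oplus>\<^bsub>chains X n\<^esub> dpos X (n + 1) v \<oplus>\<^bsub>chains X n\<^esub> dneg X (n + 1) u)}"

definition hclass :: "('r, 'a) pm_complex \<Rightarrow> int \<Rightarrow> 'a \<Rightarrow> 'a set" where
  "hclass X n x = homology_rel X n `` {x}"

definition homology :: "('r, 'a) pm_complex \<Rightarrow> int \<Rightarrow> ('r, 'a set) module" where
  "homology X n = \<lparr>
    carrier = cycles X n // homology_rel X n,
    monoid.mult = undefined,
    one = undefined,
    zero = hclass X n \<zero>\<^bsub>chains X n\<^esub>,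
    add = (\<lambda>U V. \<Union>x\<in>U. \<Union>y\<in>V. hclass X n (x \<oplus>\<^bsub>chains X n\<^esub> y)),
    smult = (\<lambda>r U. \<Union>x\<in>U. hclass X n (r \<odot>\<^bsub>chains X n\<^esub> x)) \<rparr>"

text \<open>
  A morphism need not preserve cycles or homologous pairs; the predicate below expresses that
  the induced map is defined, and only then is \<open>homology_map\<close> meaningful.
\<close>

definition homology_map_defined ::
  "('r, 'a) pm_complex \<Rightarrow> ('r, 'b) pm_complex \<Rightarrow> (int \<Rightarrow> 'a \<Rightarrow> 'b) \<Rightarrow> int \<Rightarrow> bool" where
  "homology_map_defined X X' f n \<longleftrightarrow>
    f n ` cycles X n \<subseteq> cycles X' n \<and>
    (\<forall>(x, y)\<in>homology_rel X n. hclass X' n (f n x) = hclass X' n (f n y))"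

definition homology_map ::
  "('r, 'b) pm_complex \<Rightarrow> (int \<Rightarrow> 'a \<Rightarrow> 'b) \<Rightarrow> int \<Rightarrow> 'a set \<Rightarrow> 'b set" where
  "homology_map X' f n U = (\<Union>x\<in>U. hclass X' n (f n x))"


section \<open>Completion of complexes and the connecting homomorphism\<close>

definition completion_complex ::
  "('r, 'a) pm_complex \<Rightarrow> ('r, ('a \<times> 'a) set) pm_complex" where
  "completion_complex X =
    ordinary (\<lambda>n. completion (chains X n))
      (\<lambda>n U. completion_map (chains X (n - 1)) (dpos X n) U
        \<ominus>\<^bsub>completion (chains X (n - 1))\<^esub> completion_map (chains X (n - 1)) (dneg X n) U)"

definition completion_morphism ::
  "('r, 'b) pm_complex \<Rightarrow> (int \<Rightarrow> 'a \<Rightarrow> 'b) \<Rightarrow> int \<Rightarrow> ('a \<times> 'a) set \<Rightarrow> ('b \<times> 'b) set" where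
  "completion_morphism X' f n = completion_map (chains X' n) (f n)"

definition complex_unit :: "('r, 'a) pm_complex \<Rightarrow> int \<Rightarrow> 'a \<Rightarrow> ('a \<times> 'a) set" where
  "complex_unit X n = completion_unit (chains X n)"

text \<open>
  The usual connecting homomorphism \<open>H\<^sub>n(C) \<rightarrow> H\<^sub>n\<^sub>-\<^sub>1(A)\<close> of a short exact sequence of ordinary
  chain complexes of modules: \<open>cl(c) \<mapsto> cl(a)\<close> where \<open>g b = c\<close> and \<open>f a = \<partial> b\<close>.  For an ordinary
  complex the differential is \<open>dpos\<close>.
\<close>

definition connecting_hom ::
  "('r, 'a) pm_complex \<Rightarrow> ('r, 'b) pm_complex \<Rightarrow> (int \<Rightarrow> 'a \<Rightarrow> 'b) \<Rightarrow> (int \<Rightarrow> 'b \<Rightarrow> 'c)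
    \<Rightarrow> int \<Rightarrow> 'c set \<Rightarrow> 'a set" where
  "connecting_hom A B f g n U =
    (THE W. \<exists>c\<in>U. \<exists>b\<in>carrier (chains B n). \<exists>a\<in>cycles A (n - 1).
      g n b = c \<and> f (n - 1) a = dpos B n b \<and> W = hclass A (n - 1) a)"

text \<open>
  The connecting homomorphism of the completed sequence, with values in the homology of \<open>G\<close>
  itself: for a complex \<open>G\<close> of modules, the homology of its completion is identified with the
  homology of \<open>G\<close> via the bijection induced by the canonical map.
\<close>

definition completed_connecting ::
  "('r, 'g) pm_complex \<Rightarrow> ('r, 'b) pm_complex \<Rightarrow> ('r, 'c) pm_complex
    \<Rightarrow> (int \<Rightarrow> 'g \<Rightarrow> 'b) \<Rightarrow> (int \<Rightarrow> 'b \<Rightarrow> 'c) \<Rightarrow> int \<Rightarrow> ('c \<times> 'c) set set \<Rightarrow> 'g set" where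
  "completed_connecting G B C \<kappa> \<sigma> n U =
    inv_into (carrier (homology G (n - 1)))
      (homology_map (completion_complex G) (complex_unit G) (n - 1))
      (connecting_hom (completion_complex G) (completion_complex B)
        (completion_morphism B \<kappa>) (completion_morphism C \<sigma>) n U)"

definition boundary ::
  "('r, 'g) pm_complex \<Rightarrow> ('r, 'b) pm_complex \<Rightarrow> ('r, 'c) pm_complex
    \<Rightarrow> (int \<Rightarrow> 'g \<Rightarrow> 'b) \<Rightarrow> (int \<Rightarrow> 'b \<Rightarrow> 'c) \<Rightarrow> int \<Rightarrow> 'c set \<Rightarrow> 'g set" where
  "boundary G B C \<kappa> \<sigma> n =
    completed_connecting G B C \<kappa> \<sigma> n \<circ> homology_map (completion_complex C) (complex_unit C) n"

end

theory Submission
  imports Defs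
begin

text \<open>
  Write \<open>K\<close> for group completion.  Since each \<open>G\<^sub>n\<close> is a group, the Schreier condition makes \<open>G\<^sub>n\<close>
  act on \<open>B\<^sub>n\<close>, through \<open>\<kappa>\<close> and addition, freely and transitively on every fibre of \<open>\<sigma>\<close>
  (\<open>fibre_free\<close>, \<open>fibre_transitive\<close>).  So although nothing can be subtracted in
  \<open>B\<close>, two elements with the same image in \<open>C\<close> have a difference, a unique element of \<open>G\<close>; and
  this difference is a cycle whenever the two elements have a formal difference that is a cycle
  (\<open>cycle_of_cycle_pair\<close>).

  Exactness at \<open>H\<^sub>n(B)\<close> and normality of \<open>H\<^sub>n(\<sigma>)\<close>: a homology between \<open>\<sigma> b\<close> and \<open>\<sigma> b'\<close> in \<open>C\<close> is
  lifted to \<open>B\<close> and becomes an equality of images under \<open>\<sigma>\<close>.  This requires commuting \<open>\<sigma>\<close> with the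
  differentials inside an equation, which is possible if \<open>\<sigma>\<close> respects \<open>\<partial>\<^sup>+\<close> and \<open>\<partial>\<^sup>-\<close> separately, or if
  \<open>C\<close> is cancellative (\<open>map_boundary_iff\<close>, \<open>map_cycle_iff\<close>).  The difference of the two lifts is a
  cycle \<open>g\<close> of \<open>G\<close>, and \<open>b\<close> is homologous to \<open>\<kappa> g + b'\<close> (\<open>homologous_images\<close>).

  The remaining assertions follow from a description by representatives of the connecting
  homomorphism of the completed sequence.  It sends the class of \<open>[\<sigma> u, \<sigma> v]\<close> to that of \<open>g\<close> if, for
  some \<open>z\<close> in \<open>B\<close>,
  \<open>\<partial>\<^sup>+ u + \<partial>\<^sup>- v + z = \<kappa> g + \<partial>\<^sup>+ v + \<partial>\<^sup>- u + z\<close>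
  (\<open>completed_connecting_lifts\<close>); the summand \<open>z\<close> witnesses an equality in \<open>K(B)\<close>.  Classes of
  cycles of \<open>C\<close> have such data with \<open>v = 0\<close> and \<open>z = 0\<close>, and if \<open>g\<close> is then a boundary, moving \<open>u\<close> by
  the action of \<open>G\<close> produces a cycle over the given one: this is exactness at \<open>H\<^sub>n(C)\<close>.  On the other
  hand \<open>\<kappa> g\<close> is null-homologous in \<open>B\<close> exactly if the equation can be solved with \<open>z = 0\<close>.
  Therefore the image of \<open>H\<^sub>n(C)\<close> is contained in the kernel of \<open>H\<^sub>n\<^sub>-\<^sub>1(\<kappa>)\<close>, which in turn is
  contained in the image of \<open>H\<^sub>n(K(C))\<close>.  If the outer two agree, the sequence is exact at
  \<open>H\<^sub>n\<^sub>-\<^sub>1(G)\<close>.  If \<open>C\<close> is cancellative, so is \<open>B\<close>, the summand \<open>z\<close> can always be dropped, the last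
  inclusion is an equality, and the converse holds as well.
\<close>

section \<open>Quotients of semimodules by congruences\<close>

lemma (in semimodule) smult_r_zero:
  assumes "r \<in> carrier R"
  shows "r \<odot>\<^bsub>M\<^esub> \<zero>\<^bsub>M\<^esub> = \<zero>\<^bsub>M\<^esub>"
proof -
  have "r \<odot>\<^bsub>M\<^esub> \<zero>\<^bsub>M\<^esub> = r \<odot>\<^bsub>M\<^esub> (\<zero> \<odot>\<^bsub>M\<^esub> \<zero>\<^bsub>M\<^esub>)"
    by (simp add: smult_zero)
  also have "\<dots> = (r \<otimes> \<zero>) \<odot>\<^bsub>M\<^esub> \<zero>\<^bsub>M\<^esub>"
    using assms by (intro smult_assoc1[symmetric]) simp_all
  finally show ?thesis using assms by (simp add: smult_zero)
qed

lemma semimodule_homI: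
  assumes "semimodule R A" "semimodule R B"
    and "\<And>x. x \<in> carrier A \<Longrightarrow> f x \<in> carrier B"
    and "\<And>x y. x \<in> carrier A \<Longrightarrow> y \<in> carrier A \<Longrightarrow> f (x \<oplus>\<^bsub>A\<^esub> y) = f x \<oplus>\<^bsub>B\<^esub> f y"
    and "\<And>r x. r \<in> carrier R \<Longrightarrow> x \<in> carrier A \<Longrightarrow> f (r \<odot>\<^bsub>A\<^esub> x) = r \<odot>\<^bsub>B\<^esub> f x"
  shows "semimodule_hom R A B f"
  using assms by (simp add: semimodule_hom_def semimodule_hom_axioms_def)

lemma (in semimodule_hom) hom_zero: "f \<zero>\<^bsub>A\<^esub> = \<zero>\<^bsub>B\<^esub>"
proof -
  have "f \<zero>\<^bsub>A\<^esub> = f (\<zero> \<odot>\<^bsub>A\<^esub> \<zero>\<^bsub>A\<^esub>)" by (simp add: A.smult_zero)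
  also have "\<dots> = \<zero> \<odot>\<^bsub>B\<^esub> f \<zero>\<^bsub>A\<^esub>" by (rule hom_smult) simp_all
  finally show ?thesis by (simp add: B.smult_zero hom_closed)
qed

lemma (in semimodule) subsemimodule:
  assumes "S \<subseteq> carrier M" "\<zero>\<^bsub>M\<^esub> \<in> S"
    and "\<And>x y. x \<in> S \<Longrightarrow> y \<in> S \<Longrightarrow> x \<oplus>\<^bsub>M\<^esub> y \<in> S"
    and "\<And>r x. r \<in> carrier R \<Longrightarrow> x \<in> S \<Longrightarrow> r \<odot>\<^bsub>M\<^esub> x \<in> S"
  shows "semimodule R (M\<lparr>carrier := S\<rparr>)"
proof -
  have S: "x \<in> carrier M" if "x \<in> S" for x using assms(1) that by blast
  have "abelian_monoid (M\<lparr>carrier := S\<rparr>)"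
    by (rule abelian_monoidI) (simp_all add: assms S a_assoc a_comm a_lcomm)
  then show ?thesis
    using semiring_axioms
    by (simp add: semimodule_def semimodule_axioms_def assms S smult_l_distr smult_r_distr
        smult_assoc1 smult_one smult_zero)
qed

text \<open>
  Group completions and homology semimodules are both quotients of a semimodule by a congruence:
  of \<open>A \<times> A\<close> in one case, of the cycles in the other.  Working out the quotient once gives the
  semimodule laws and the induced homomorphisms for both.
\<close>

definition quotient_semimodule ::
  "('r, 'a) module \<Rightarrow> ('a \<times> 'a) set \<Rightarrow> ('r, 'a set) module" where
  "quotient_semimodule M \<theta> = \<lparr>
    carrier = carrier M // \<theta>,
    monoid.mult = undefined,
    one = undefined,
    zero = \<theta> `` {\<zero>\<^bsub>M\<^esub>},
    add = (\<lambda>U V. \<Union>x\<in>U. \<Union>y\<in>V. \<theta> `` {x \<oplus>\<^bsub>M\<^esub> y}),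
    smult = (\<lambda>r U. \<Union>x\<in>U. \<theta> `` {r \<odot>\<^bsub>M\<^esub> x}) \<rparr>"

locale semimodule_congruence = semimodule R M
  for R (structure) and M :: "('r, 'a) module" (structure) +
  fixes \<theta>
  assumes equiv_rel: "equiv (carrier M) \<theta>"
    and rel_add: "(x, x') \<in> \<theta> \<Longrightarrow> (y, y') \<in> \<theta> \<Longrightarrow> (x \<oplus>\<^bsub>M\<^esub> y, x' \<oplus>\<^bsub>M\<^esub> y') \<in> \<theta>"
    and rel_smult: "r \<in> carrier R \<Longrightarrow> (x, x') \<in> \<theta> \<Longrightarrow> (r \<odot>\<^bsub>M\<^esub> x, r \<odot>\<^bsub>M\<^esub> x') \<in> \<theta>"
begin

lemma class_eq_iff:
  "x \<in> carrier M \<Longrightarrow> y \<in> carrier M \<Longrightarrow> \<theta> `` {x} = \<theta> `` {y} \<longleftrightarrow> (x, y) \<in> \<theta>"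
  by (rule eq_equiv_class_iff[OF equiv_rel])

lemma class_closed: "x \<in> carrier M \<Longrightarrow> \<theta> `` {x} \<in> carrier (quotient_semimodule M \<theta>)"
  by (simp add: quotient_semimodule_def quotientI)

lemma classE:
  assumes "U \<in> carrier (quotient_semimodule M \<theta>)"
  obtains x where "x \<in> carrier M" "U = \<theta> `` {x}"
  using assms by (auto simp: quotient_semimodule_def elim: quotientE)

lemma class_zero: "\<zero>\<^bsub>quotient_semimodule M \<theta>\<^esub> = \<theta> `` {\<zero>\<^bsub>M\<^esub>}"
  by (simp add: quotient_semimodule_def)

lemma class_add:
  assumes "x \<in> carrier M" "y \<in> carrier M"
  shows "\<theta> `` {x} \<oplus>\<^bsub>quotient_semimodule M \<theta>\<^esub> \<theta> `` {y} = \<theta> `` {x \<oplus>\<^bsub>M\<^esub> y}"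
proof -
  have "congruent2 \<theta> \<theta> (\<lambda>x y. \<theta> `` {x \<oplus>\<^bsub>M\<^esub> y})"
    by (auto simp: congruent2_def intro!: equiv_class_eq[OF equiv_rel] rel_add)
  from UN_equiv_class2[OF equiv_rel equiv_rel this assms]
  show ?thesis by (simp add: quotient_semimodule_def)
qed

lemma class_smult:
  assumes "r \<in> carrier R" "x \<in> carrier M"
  shows "r \<odot>\<^bsub>quotient_semimodule M \<theta>\<^esub> \<theta> `` {x} = \<theta> `` {r \<odot>\<^bsub>M\<^esub> x}"
proof -
  have "congruent \<theta> (\<lambda>x. \<theta> `` {r \<odot>\<^bsub>M\<^esub> x})"
    by (auto simp: congruent_def intro!: equiv_class_eq[OF equiv_rel] rel_smult assms(1))
  from UN_equiv_class[OF equiv_rel this assms(2)]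
  show ?thesis by (simp add: quotient_semimodule_def)
qed

lemma semimodule_quotient: "semimodule R (quotient_semimodule M \<theta>)" (is "semimodule R ?Q")
proof -
  note [simp] = class_closed class_zero class_add class_smult smult_closed
  have "abelian_monoid ?Q"
  proof (rule abelian_monoidI)
    fix x y z
    assume "x \<in> carrier ?Q" "y \<in> carrier ?Q" "z \<in> carrier ?Q"
    then show "x \<oplus>\<^bsub>?Q\<^esub> y \<oplus>\<^bsub>?Q\<^esub> z = x \<oplus>\<^bsub>?Q\<^esub> (y \<oplus>\<^bsub>?Q\<^esub> z)"
      by (auto elim!: classE simp: M.a_assoc)
  qed (auto elim!: classE simp: M.a_comm)
  then show ?thesis
    using semiring_axioms
    by (auto simp: semimodule_def semimodule_axioms_def smult_l_distr smult_r_distr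
        smult_assoc1 smult_one smult_zero elim!: classE)
qed

end

definition induced_map :: "('b \<times> 'b) set \<Rightarrow> ('a \<Rightarrow> 'b) \<Rightarrow> 'a set \<Rightarrow> 'b set" where
  "induced_map \<eta> f U = (\<Union>x\<in>U. \<eta> `` {f x})"

lemma
  assumes M: "semimodule_congruence R M \<theta>" and N: "semimodule_congruence R N \<eta>"
    and f: "semimodule_hom R M N f"
    and rel: "\<And>x y. (x, y) \<in> \<theta> \<Longrightarrow> (f x, f y) \<in> \<eta>"
  shows induced_map_class: "\<And>x. x \<in> carrier M \<Longrightarrow> induced_map \<eta> f (\<theta> `` {x}) = \<eta> `` {f x}"
    and induced_map_hom:
      "semimodule_hom R (quotient_semimodule M \<theta>) (quotient_semimodule N \<eta>) (induced_map \<eta> f)"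
proof -
  interpret M: semimodule_congruence R M \<theta> by fact
  interpret N: semimodule_congruence R N \<eta> by fact
  interpret f: semimodule_hom R M N f by fact
  have "congruent \<theta> (\<lambda>x. \<eta> `` {f x})"
    by (auto simp: congruent_def intro!: equiv_class_eq[OF N.equiv_rel] rel)
  then show cl: "induced_map \<eta> f (\<theta> `` {x}) = \<eta> `` {f x}" if "x \<in> carrier M" for x
    unfolding induced_map_def by (rule UN_equiv_class[OF M.equiv_rel _ that])
  show "semimodule_hom R (quotient_semimodule M \<theta>) (quotient_semimodule N \<eta>) (induced_map \<eta> f)"
    by (rule semimodule_homI[OF M.semimodule_quotient N.semimodule_quotient])
      (auto elim!: M.classE simp: cl f.hom_closed N.class_closed M.class_add N.class_add
        M.class_smult N.class_smult M.smult_closed f.hom_add f.hom_smult)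
qed

section \<open>Homology of complexes of semimodules\<close>

lemma (in abelian_monoid) sum_of_triples:
  assumes "x \<in> carrier G" "a \<in> carrier G" "b \<in> carrier G"
    and "y \<in> carrier G" "c \<in> carrier G" "e \<in> carrier G"
  shows "x \<oplus> y \<oplus> (a \<oplus> c) \<oplus> (b \<oplus> e) = (x \<oplus> a \<oplus> b) \<oplus> (y \<oplus> c \<oplus> e)"
  using assms by (simp add: a_ac)

locale semimodule_complex =
  fixes R :: "('r, 'm) ring_scheme" and X :: "('r, 'a) pm_complex"
  assumes complex: "chain_complex R X"
begin

lemma dpos_hom: "semimodule_hom R (chains X n) (chains X (n - 1)) (dpos X n)"
  and dneg_hom: "semimodule_hom R (chains X n) (chains X (n - 1)) (dneg X n)"
  using complex by (simp_all add: chain_complex_def)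

sublocale ch: semimodule R "chains X n" for n
  using dpos_hom[of n] by (simp add: semimodule_hom_def)

declare ch.smult_closed [simp]

lemma diff_closed [simp]:
  assumes "x \<in> carrier (chains X n)" "m = n - 1"
  shows "dpos X n x \<in> carrier (chains X m)" "dneg X n x \<in> carrier (chains X m)"
  using assms semimodule_hom.hom_closed[OF dpos_hom] semimodule_hom.hom_closed[OF dneg_hom]
  by simp_all

lemma diff_add [simp]:
  assumes "x \<in> carrier (chains X n)" "y \<in> carrier (chains X n)"
  shows "dpos X n (x \<oplus>\<^bsub>chains X n\<^esub> y) = dpos X n x \<oplus>\<^bsub>chains X (n - 1)\<^esub> dpos X n y"
    and "dneg X n (x \<oplus>\<^bsub>chains X n\<^esub> y) = dneg X n x \<oplus>\<^bsub>chains X (n - 1)\<^esub> dneg X n y"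
  using assms semimodule_hom.hom_add[OF dpos_hom] semimodule_hom.hom_add[OF dneg_hom]
  by simp_all

lemma diff_smult [simp]:
  assumes "r \<in> carrier R" "x \<in> carrier (chains X n)"
  shows "dpos X n (r \<odot>\<^bsub>chains X n\<^esub> x) = r \<odot>\<^bsub>chains X (n - 1)\<^esub> dpos X n x"
    and "dneg X n (r \<odot>\<^bsub>chains X n\<^esub> x) = r \<odot>\<^bsub>chains X (n - 1)\<^esub> dneg X n x"
  using assms semimodule_hom.hom_smult[OF dpos_hom] semimodule_hom.hom_smult[OF dneg_hom]
  by simp_all

lemma diff_zero [simp]:
  "dpos X n \<zero>\<^bsub>chains X n\<^esub> = \<zero>\<^bsub>chains X (n - 1)\<^esub>"
  "dneg X n \<zero>\<^bsub>chains X n\<^esub> = \<zero>\<^bsub>chains X (n - 1)\<^esub>"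
  using semimodule_hom.hom_zero[OF dpos_hom] semimodule_hom.hom_zero[OF dneg_hom] by simp_all

lemma diff_diff:
  "x \<in> carrier (chains X (n + 1)) \<Longrightarrow>
    dpos X n (dpos X (n + 1) x) \<oplus>\<^bsub>chains X (n - 1)\<^esub> dneg X n (dneg X (n + 1) x) =
    dpos X n (dneg X (n + 1) x) \<oplus>\<^bsub>chains X (n - 1)\<^esub> dneg X n (dpos X (n + 1) x)"
  using complex by (simp add: chain_complex_def)

abbreviation cycle_module :: "int \<Rightarrow> ('r, 'a) module" where
  "cycle_module n \<equiv> (chains X n)\<lparr>carrier := cycles X n\<rparr>"

lemma cycle_closed: "x \<in> cycles X n \<Longrightarrow> x \<in> carrier (chains X n)"
  by (simp add: cycles_def)

lemma zero_cycle: "\<zero>\<^bsub>chains X n\<^esub> \<in> cycles X n"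
  and add_cycle: "x \<in> cycles X n \<Longrightarrow> y \<in> cycles X n \<Longrightarrow> x \<oplus>\<^bsub>chains X n\<^esub> y \<in> cycles X n"
  and smult_cycle: "r \<in> carrier R \<Longrightarrow> x \<in> cycles X n \<Longrightarrow> r \<odot>\<^bsub>chains X n\<^esub> x \<in> cycles X n"
  by (simp_all add: cycles_def)

lemma semimodule_cycles: "semimodule R (cycle_module n)"
  by (rule ch.subsemimodule) (auto simp: cycle_closed zero_cycle add_cycle smult_cycle)

lemma homology_relI:
  assumes "x \<in> cycles X n" "y \<in> cycles X n"
    and "u \<in> carrier (chains X (n + 1))" "v \<in> carrier (chains X (n + 1))"
    and "x \<oplus>\<^bsub>chains X n\<^esub> dpos X (n + 1) u \<oplus>\<^bsub>chains X n\<^esub> dneg X (n + 1) v =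
      y \<oplus>\<^bsub>chains X n\<^esub> dpos X (n + 1) v \<oplus>\<^bsub>chains X n\<^esub> dneg X (n + 1) u"
  shows "(x, y) \<in> homology_rel X n"
  using assms by (auto simp: homology_rel_def)

lemma homology_relE:
  assumes "(x, y) \<in> homology_rel X n"
  obtains u v where "x \<in> cycles X n" "y \<in> cycles X n"
    "u \<in> carrier (chains X (n + 1))" "v \<in> carrier (chains X (n + 1))"
    "x \<oplus>\<^bsub>chains X n\<^esub> dpos X (n + 1) u \<oplus>\<^bsub>chains X n\<^esub> dneg X (n + 1) v =
      y \<oplus>\<^bsub>chains X n\<^esub> dpos X (n + 1) v \<oplus>\<^bsub>chains X n\<^esub> dneg X (n + 1) u"
  using assms by (auto simp: homology_rel_def)

lemma homology_rel_add:
  assumes "(x, x') \<in> homology_rel X n" "(y, y') \<in> homology_rel X n"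
  shows "(x \<oplus>\<^bsub>chains X n\<^esub> y, x' \<oplus>\<^bsub>chains X n\<^esub> y') \<in> homology_rel X n"
proof -
  from assms(1) obtain u v where uv: "x \<in> cycles X n" "x' \<in> cycles X n"
    "u \<in> carrier (chains X (n + 1))" "v \<in> carrier (chains X (n + 1))"
    "x \<oplus>\<^bsub>chains X n\<^esub> dpos X (n + 1) u \<oplus>\<^bsub>chains X n\<^esub> dneg X (n + 1) v =
      x' \<oplus>\<^bsub>chains X n\<^esub> dpos X (n + 1) v \<oplus>\<^bsub>chains X n\<^esub> dneg X (n + 1) u"
    by (rule homology_relE)
  from assms(2) obtain s t where st: "y \<in> cycles X n" "y' \<in> cycles X n"
    "s \<in> carrier (chains X (n + 1))" "t \<in> carrier (chains X (n + 1))"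
    "y \<oplus>\<^bsub>chains X n\<^esub> dpos X (n + 1) s \<oplus>\<^bsub>chains X n\<^esub> dneg X (n + 1) t =
      y' \<oplus>\<^bsub>chains X n\<^esub> dpos X (n + 1) t \<oplus>\<^bsub>chains X n\<^esub> dneg X (n + 1) s"
    by (rule homology_relE)
  show ?thesis
    by (rule homology_relI[of _ _ _ "u \<oplus>\<^bsub>chains X (n + 1)\<^esub> s" "v \<oplus>\<^bsub>chains X (n + 1)\<^esub> t"])
      (use uv st in \<open>simp_all add: add_cycle cycle_closed ch.sum_of_triples\<close>)
qed

lemma homology_rel_trans:
  assumes "(x, y) \<in> homology_rel X n" "(y, z) \<in> homology_rel X n"
  shows "(x, z) \<in> homology_rel X n"
proof -
  from assms(1) obtain u v where uv: "x \<in> cycles X n" "y \<in> cycles X n"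
    "u \<in> carrier (chains X (n + 1))" "v \<in> carrier (chains X (n + 1))"
    "x \<oplus>\<^bsub>chains X n\<^esub> dpos X (n + 1) u \<oplus>\<^bsub>chains X n\<^esub> dneg X (n + 1) v =
      y \<oplus>\<^bsub>chains X n\<^esub> dpos X (n + 1) v \<oplus>\<^bsub>chains X n\<^esub> dneg X (n + 1) u"
    by (rule homology_relE)
  from assms(2) obtain s t where st: "y \<in> cycles X n" "z \<in> cycles X n"
    "s \<in> carrier (chains X (n + 1))" "t \<in> carrier (chains X (n + 1))"
    "y \<oplus>\<^bsub>chains X n\<^esub> dpos X (n + 1) s \<oplus>\<^bsub>chains X n\<^esub> dneg X (n + 1) t =
      z \<oplus>\<^bsub>chains X n\<^esub> dpos X (n + 1) t \<oplus>\<^bsub>chains X n\<^esub> dneg X (n + 1) s"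
    by (rule homology_relE)
  note [simp] = uv(1-4) st(1-4) uv(1-2)[THEN cycle_closed] st(1-2)[THEN cycle_closed]
  let ?p = "dpos X (n + 1)" and ?m = "dneg X (n + 1)" and ?C = "chains X n"
  have "x \<oplus>\<^bsub>?C\<^esub> (?p u \<oplus>\<^bsub>?C\<^esub> ?p s) \<oplus>\<^bsub>?C\<^esub> (?m v \<oplus>\<^bsub>?C\<^esub> ?m t)
      = (x \<oplus>\<^bsub>?C\<^esub> ?p u \<oplus>\<^bsub>?C\<^esub> ?m v) \<oplus>\<^bsub>?C\<^esub> (?p s \<oplus>\<^bsub>?C\<^esub> ?m t)"
    by (simp add: ch.a_ac)
  also have "\<dots> = (y \<oplus>\<^bsub>?C\<^esub> ?p s \<oplus>\<^bsub>?C\<^esub> ?m t) \<oplus>\<^bsub>?C\<^esub> (?p v \<oplus>\<^bsub>?C\<^esub> ?m u)"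
    unfolding uv(5) by (simp add: ch.a_ac)
  also have "\<dots> = z \<oplus>\<^bsub>?C\<^esub> (?p v \<oplus>\<^bsub>?C\<^esub> ?p t) \<oplus>\<^bsub>?C\<^esub> (?m u \<oplus>\<^bsub>?C\<^esub> ?m s)"
    unfolding st(5) by (simp add: ch.a_ac)
  finally show ?thesis
    by (intro homology_relI[of _ _ _ "u \<oplus>\<^bsub>chains X (n + 1)\<^esub> s" "v \<oplus>\<^bsub>chains X (n + 1)\<^esub> t"])
      simp_all
qed

lemma homology_congruence: "semimodule_congruence R (cycle_module n) (homology_rel X n)"
proof -
  interpret Z: semimodule R "cycle_module n" by (rule semimodule_cycles)
  have "refl_on (cycles X n) (homology_rel X n)"
  proof (rule refl_onI)
    fix x assume "x \<in> cycles X n"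
    then show "(x, x) \<in> homology_rel X n"
      by (intro homology_relI[of _ _ _ "\<zero>\<^bsub>chains X (n + 1)\<^esub>" "\<zero>\<^bsub>chains X (n + 1)\<^esub>"]) simp_all
  qed
  moreover have "homology_rel X n \<subseteq> cycles X n \<times> cycles X n"
    by (auto simp: homology_rel_def)
  moreover have "sym (homology_rel X n)"
    by (rule symI) (auto elim!: homology_relE intro: homology_relI[OF _ _ _ _ sym])
  moreover have "trans (homology_rel X n)"
    by (rule transI) (rule homology_rel_trans)
  ultimately have "equiv (cycles X n) (homology_rel X n)"
    by (simp add: equiv_def)
  moreover have "(r \<odot>\<^bsub>chains X n\<^esub> x, r \<odot>\<^bsub>chains X n\<^esub> y) \<in> homology_rel X n"
    if r: "r \<in> carrier R" and "(x, y) \<in> homology_rel X n" for r x y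
  proof -
    from that(2) obtain u v where uv: "x \<in> cycles X n" "y \<in> cycles X n"
      "u \<in> carrier (chains X (n + 1))" "v \<in> carrier (chains X (n + 1))"
      "x \<oplus>\<^bsub>chains X n\<^esub> dpos X (n + 1) u \<oplus>\<^bsub>chains X n\<^esub> dneg X (n + 1) v =
        y \<oplus>\<^bsub>chains X n\<^esub> dpos X (n + 1) v \<oplus>\<^bsub>chains X n\<^esub> dneg X (n + 1) u"
      by (rule homology_relE)
    show ?thesis
      by (rule homology_relI[of _ _ _ "r \<odot>\<^bsub>chains X (n + 1)\<^esub> u" "r \<odot>\<^bsub>chains X (n + 1)\<^esub> v"])
        (use r uv in \<open>simp_all add: smult_cycle cycle_closed flip: ch.smult_r_distr\<close>)
  qed
  ultimately show ?thesis
    by unfold_locales (simp_all add: homology_rel_add)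
qed

lemma homology_quotient: "homology X n = quotient_semimodule (cycle_module n) (homology_rel X n)"
  by (simp add: homology_def quotient_semimodule_def hclass_def)

lemma semimodule_homology: "semimodule R (homology X n)"
  unfolding homology_quotient
  by (rule semimodule_congruence.semimodule_quotient[OF homology_congruence])

lemma hclass_eq_iff:
  assumes "x \<in> cycles X n" "y \<in> cycles X n"
  shows "hclass X n x = hclass X n y \<longleftrightarrow> (x, y) \<in> homology_rel X n"
  using semimodule_congruence.class_eq_iff[OF homology_congruence, of x n y] assms
  by (simp add: hclass_def)

lemma hclass_closed: "x \<in> cycles X n \<Longrightarrow> hclass X n x \<in> carrier (homology X n)"
  using semimodule_congruence.class_closed[OF homology_congruence, of x n]
  by (simp add: hclass_def homology_quotient)

lemma homologyE:
  assumes "U \<in> carrier (homology X n)"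
  obtains x where "x \<in> cycles X n" "U = hclass X n x"
  using semimodule_congruence.classE[OF homology_congruence, of U n] assms
  by (auto simp: hclass_def homology_quotient)

lemma homology_zero: "\<zero>\<^bsub>homology X n\<^esub> = hclass X n \<zero>\<^bsub>chains X n\<^esub>"
  by (simp add: homology_def)

lemma hclass_add:
  "x \<in> cycles X n \<Longrightarrow> y \<in> cycles X n \<Longrightarrow>
    hclass X n x \<oplus>\<^bsub>homology X n\<^esub> hclass X n y = hclass X n (x \<oplus>\<^bsub>chains X n\<^esub> y)"
  using semimodule_congruence.class_add[OF homology_congruence, of x n y]
  by (simp add: hclass_def homology_quotient)

lemma hclass_smult:
  "r \<in> carrier R \<Longrightarrow> x \<in> cycles X n \<Longrightarrow>
    r \<odot>\<^bsub>homology X n\<^esub> hclass X n x = hclass X n (r \<odot>\<^bsub>chains X n\<^esub> x)"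
  using semimodule_congruence.class_smult[OF homology_congruence, of r x n]
  by (simp add: hclass_def homology_quotient)

end

text \<open>
  Only the components are required to be homomorphisms here: neither \<open>\<kappa>\<close> nor \<open>\<sigma>\<close> need commute with
  the differentials separately, so that the existence of the induced map on homology is a
  hypothesis to be discharged case by case.
\<close>

locale semimodule_complex_maps =
  X: semimodule_complex R X + X': semimodule_complex R X'
  for R :: "('r, 'm) ring_scheme" and X :: "('r, 'a) pm_complex" and X' :: "('r, 'b) pm_complex" +
  fixes f :: "int \<Rightarrow> 'a \<Rightarrow> 'b"
  assumes component_hom: "semimodule_hom R (chains X n) (chains X' n) (f n)"
begin

lemma map_closed [simp]: "x \<in> carrier (chains X n) \<Longrightarrow> f n x \<in> carrier (chains X' n)"
  by (rule semimodule_hom.hom_closed[OF component_hom])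

lemma map_add [simp]:
  "x \<in> carrier (chains X n) \<Longrightarrow> y \<in> carrier (chains X n) \<Longrightarrow>
    f n (x \<oplus>\<^bsub>chains X n\<^esub> y) = f n x \<oplus>\<^bsub>chains X' n\<^esub> f n y"
  by (rule semimodule_hom.hom_add[OF component_hom])

lemma map_smult [simp]:
  "r \<in> carrier R \<Longrightarrow> x \<in> carrier (chains X n) \<Longrightarrow>
    f n (r \<odot>\<^bsub>chains X n\<^esub> x) = r \<odot>\<^bsub>chains X' n\<^esub> f n x"
  by (rule semimodule_hom.hom_smult[OF component_hom])

lemma map_zero [simp]: "f n \<zero>\<^bsub>chains X n\<^esub> = \<zero>\<^bsub>chains X' n\<^esub>"
  by (rule semimodule_hom.hom_zero[OF component_hom])

lemma homology_map_definedI: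
  assumes cyc: "\<And>x. x \<in> cycles X n \<Longrightarrow> f n x \<in> cycles X' n"
    and bd: "\<And>x y u v. x \<in> cycles X n \<Longrightarrow> y \<in> cycles X n \<Longrightarrow>
      u \<in> carrier (chains X (n + 1)) \<Longrightarrow> v \<in> carrier (chains X (n + 1)) \<Longrightarrow>
      x \<oplus>\<^bsub>chains X n\<^esub> dpos X (n + 1) u \<oplus>\<^bsub>chains X n\<^esub> dneg X (n + 1) v =
        y \<oplus>\<^bsub>chains X n\<^esub> dpos X (n + 1) v \<oplus>\<^bsub>chains X n\<^esub> dneg X (n + 1) u \<Longrightarrow>
      f n x \<oplus>\<^bsub>chains X' n\<^esub> dpos X' (n + 1) (f (n + 1) u)
          \<oplus>\<^bsub>chains X' n\<^esub> dneg X' (n + 1) (f (n + 1) v) =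
        f n y \<oplus>\<^bsub>chains X' n\<^esub> dpos X' (n + 1) (f (n + 1) v)
          \<oplus>\<^bsub>chains X' n\<^esub> dneg X' (n + 1) (f (n + 1) u)"
  shows "homology_map_defined X X' f n"
proof -
  have "hclass X' n (f n x) = hclass X' n (f n y)" if "(x, y) \<in> homology_rel X n" for x y
  proof -
    from that obtain u v where uv: "x \<in> cycles X n" "y \<in> cycles X n"
      "u \<in> carrier (chains X (n + 1))" "v \<in> carrier (chains X (n + 1))"
      "x \<oplus>\<^bsub>chains X n\<^esub> dpos X (n + 1) u \<oplus>\<^bsub>chains X n\<^esub> dneg X (n + 1) v =
        y \<oplus>\<^bsub>chains X n\<^esub> dpos X (n + 1) v \<oplus>\<^bsub>chains X n\<^esub> dneg X (n + 1) u"
      by (rule X.homology_relE)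
    then have "(f n x, f n y) \<in> homology_rel X' n"
      by (intro X'.homology_relI[OF _ _ _ _ bd]) (auto intro: cyc)
    then show ?thesis using uv cyc by (simp add: X'.hclass_eq_iff)
  qed
  then show ?thesis using cyc by (auto simp: homology_map_defined_def)
qed

lemma
  assumes defd: "homology_map_defined X X' f n"
  shows homology_map_hclass:
      "\<And>x. x \<in> cycles X n \<Longrightarrow> homology_map X' f n (hclass X n x) = hclass X' n (f n x)"
    and homology_map_hom:
      "semimodule_hom R (homology X n) (homology X' n) (homology_map X' f n)"
proof -
  have cyc: "f n x \<in> cycles X' n" if "x \<in> cycles X n" for x
    using defd that by (auto simp: homology_map_defined_def)
  have hom: "semimodule_hom R (X.cycle_module n) (X'.cycle_module n) (f n)"
    by (rule semimodule_homI[OF X.semimodule_cycles X'.semimodule_cycles])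
      (auto simp: cyc X.cycle_closed)
  have rel: "(f n x, f n y) \<in> homology_rel X' n" if "(x, y) \<in> homology_rel X n" for x y
    using defd that cyc X'.hclass_eq_iff[of "f n x" n "f n y"]
    by (fastforce simp: homology_map_defined_def elim: X.homology_relE)
  have ind: "homology_map X' f n = induced_map (homology_rel X' n) (f n)"
    by (auto simp: fun_eq_iff homology_map_def induced_map_def hclass_def)
  note * = X.homology_congruence X'.homology_congruence hom rel
  show "homology_map X' f n (hclass X n x) = hclass X' n (f n x)" if "x \<in> cycles X n" for x
    using induced_map_class[OF *] that by (simp add: ind hclass_def)
  show "semimodule_hom R (homology X n) (homology X' n) (homology_map X' f n)"
    using induced_map_hom[OF *] by (simp add: ind X.homology_quotient X'.homology_quotient)
qed

end

text \<open>
  For a morphism \<open>f\<close> the elements \<open>p = \<partial>\<^sup>+ f u\<close>, \<open>m = \<partial>\<^sup>- f u\<close>, \<open>P = f \<partial>\<^sup>+ u\<close>, \<open>M = f \<partial>\<^sup>- u\<close>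
  satisfy \<open>p + M = m + P\<close>, that is, \<open>p - m = P - M\<close> in the completion.  Cancellation thus lets
  \<open>(P, M)\<close> be traded for \<open>(p, m)\<close> on both sides of an equation; \<open>M + M'\<close> is the summand to add
  and cancel.
\<close>

lemma (in abelian_monoid) exchange_differentials:
  assumes canc: "\<And>z x y. z \<in> carrier G \<Longrightarrow> x \<in> carrier G \<Longrightarrow> y \<in> carrier G \<Longrightarrow>
      z \<oplus> x = z \<oplus> y \<Longrightarrow> x = y"
    and [simp]: "c \<in> carrier G" "c' \<in> carrier G" "p \<in> carrier G" "m \<in> carrier G"
      "P \<in> carrier G" "M \<in> carrier G" "p' \<in> carrier G" "m' \<in> carrier G"
      "P' \<in> carrier G" "M' \<in> carrier G"
    and e: "p \<oplus> M = m \<oplus> P" and e': "p' \<oplus> M' = m' \<oplus> P'"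
    and eq: "c \<oplus> P \<oplus> M' = c' \<oplus> P' \<oplus> M"
  shows "c \<oplus> p \<oplus> m' = c' \<oplus> p' \<oplus> m"
proof (rule canc[of "M \<oplus> M'"])
  have "M \<oplus> M' \<oplus> (c \<oplus> p \<oplus> m') = (p \<oplus> M) \<oplus> (c \<oplus> m' \<oplus> M')" by (simp add: a_ac)
  also have "\<dots> = (c \<oplus> P \<oplus> M') \<oplus> (m \<oplus> m')" unfolding e by (simp add: a_ac)
  also have "\<dots> = (m' \<oplus> P') \<oplus> (c' \<oplus> M \<oplus> m)" unfolding eq by (simp add: a_ac)
  also have "\<dots> = M \<oplus> M' \<oplus> (c' \<oplus> p' \<oplus> m)" unfolding e'[symmetric] by (simp add: a_ac)
  finally show "M \<oplus> M' \<oplus> (c \<oplus> p \<oplus> m') = M \<oplus> M' \<oplus> (c' \<oplus> p' \<oplus> m)" .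
qed simp_all

locale semimodule_chain_morphism = semimodule_complex_maps +
  assumes morphism: "chain_morphism R X X' f"
begin

lemma diff_map:
  "x \<in> carrier (chains X n) \<Longrightarrow>
    dpos X' n (f n x) \<oplus>\<^bsub>chains X' (n - 1)\<^esub> f (n - 1) (dneg X n x) =
    dneg X' n (f n x) \<oplus>\<^bsub>chains X' (n - 1)\<^esub> f (n - 1) (dpos X n x)"
  using morphism by (simp add: chain_morphism_def)

end

text \<open>
  Both alternatives have the same effect: in the conditions for being a cycle and for being
  homologous, applying \<open>f\<close> before or after the differentials makes no difference.  The exactness
  arguments below appeal to the alternatives only through these two equivalences, except where
  the cancellative case is singled out.
\<close>

locale strong_chain_morphism = semimodule_chain_morphism +
  assumes strong: "pm_morphism R X X' f \<or> (\<forall>n. cancellative (chains X' n))"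
begin

lemma cancel:
  assumes "cancellative (chains X' n)" "z \<in> carrier (chains X' n)"
    and "x \<in> carrier (chains X' n)" "y \<in> carrier (chains X' n)"
  shows "z \<oplus>\<^bsub>chains X' n\<^esub> x = z \<oplus>\<^bsub>chains X' n\<^esub> y \<Longrightarrow> x = y"
  using assms unfolding cancellative_def by blast

lemma map_cycle_iff:
  assumes x: "x \<in> carrier (chains X n)"
  shows "dpos X' n (f n x) = dneg X' n (f n x) \<longleftrightarrow> f (n - 1) (dpos X n x) = f (n - 1) (dneg X n x)"
  using strong
proof
  assume "pm_morphism R X X' f"
  with x show ?thesis by (auto simp: pm_morphism_def)
next
  assume "\<forall>n. cancellative (chains X' n)"
  then have can: "cancellative (chains X' (n - 1))" by blast
  show ?thesis
  proof
    assume "dpos X' n (f n x) = dneg X' n (f n x)"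
    then show "f (n - 1) (dpos X n x) = f (n - 1) (dneg X n x)"
      by - (rule cancel[OF can, of "dneg X' n (f n x)"], use x diff_map[OF x] in simp_all)
  next
    assume "f (n - 1) (dpos X n x) = f (n - 1) (dneg X n x)"
    then show "dpos X' n (f n x) = dneg X' n (f n x)"
      by - (rule cancel[OF can, of "f (n - 1) (dneg X n x)"],
        use x diff_map[OF x] in \<open>simp_all add: X'.ch.a_comm\<close>)
  qed
qed

lemma map_boundary_iff:
  assumes [simp]: "u \<in> carrier (chains X (n + 1))" "v \<in> carrier (chains X (n + 1))"
    "c \<in> carrier (chains X' n)" "c' \<in> carrier (chains X' n)"
  shows "c \<oplus>\<^bsub>chains X' n\<^esub> dpos X' (n + 1) (f (n + 1) u)
            \<oplus>\<^bsub>chains X' n\<^esub> dneg X' (n + 1) (f (n + 1) v)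
        = c' \<oplus>\<^bsub>chains X' n\<^esub> dpos X' (n + 1) (f (n + 1) v)
            \<oplus>\<^bsub>chains X' n\<^esub> dneg X' (n + 1) (f (n + 1) u)
    \<longleftrightarrow> c \<oplus>\<^bsub>chains X' n\<^esub> f n (dpos X (n + 1) u) \<oplus>\<^bsub>chains X' n\<^esub> f n (dneg X (n + 1) v)
        = c' \<oplus>\<^bsub>chains X' n\<^esub> f n (dpos X (n + 1) v) \<oplus>\<^bsub>chains X' n\<^esub> f n (dneg X (n + 1) u)"
  using strong
proof
  assume pm: "pm_morphism R X X' f"
  have "f n (dpos X (n + 1) w) = dpos X' (n + 1) (f (n + 1) w) \<and>
      f n (dneg X (n + 1) w) = dneg X' (n + 1) (f (n + 1) w)"
    if "w \<in> carrier (chains X (n + 1))" for w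
  proof -
    have "f (n + 1 - 1) (dpos X (n + 1) w) = dpos X' (n + 1) (f (n + 1) w) \<and>
      f (n + 1 - 1) (dneg X (n + 1) w) = dneg X' (n + 1) (f (n + 1) w)"
      using pm that unfolding pm_morphism_def by blast
    then show ?thesis by simp
  qed
  then show ?thesis by simp
next
  assume "\<forall>n. cancellative (chains X' n)"
  then have can: "cancellative (chains X' n)" by blast
  have eq: "dpos X' (n + 1) (f (n + 1) w) \<oplus>\<^bsub>chains X' n\<^esub> f n (dneg X (n + 1) w) =
      dneg X' (n + 1) (f (n + 1) w) \<oplus>\<^bsub>chains X' n\<^esub> f n (dpos X (n + 1) w)"
    if "w \<in> carrier (chains X (n + 1))" for w
    using diff_map[OF that] by simp
  have eq': "f n (dpos X (n + 1) w) \<oplus>\<^bsub>chains X' n\<^esub> dneg X' (n + 1) (f (n + 1) w) =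
      f n (dneg X (n + 1) w) \<oplus>\<^bsub>chains X' n\<^esub> dpos X' (n + 1) (f (n + 1) w)"
    if "w \<in> carrier (chains X (n + 1))" for w
    using eq[OF that] that by (simp add: X'.ch.a_comm)
  show ?thesis
  proof
    assume "c \<oplus>\<^bsub>chains X' n\<^esub> f n (dpos X (n + 1) u) \<oplus>\<^bsub>chains X' n\<^esub> f n (dneg X (n + 1) v)
        = c' \<oplus>\<^bsub>chains X' n\<^esub> f n (dpos X (n + 1) v) \<oplus>\<^bsub>chains X' n\<^esub> f n (dneg X (n + 1) u)"
    from X'.ch.exchange_differentials[OF cancel[OF can] _ _ _ _ _ _ _ _ _ _ eq eq this]
    show "c \<oplus>\<^bsub>chains X' n\<^esub> dpos X' (n + 1) (f (n + 1) u)
            \<oplus>\<^bsub>chains X' n\<^esub> dneg X' (n + 1) (f (n + 1) v)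
        = c' \<oplus>\<^bsub>chains X' n\<^esub> dpos X' (n + 1) (f (n + 1) v)
            \<oplus>\<^bsub>chains X' n\<^esub> dneg X' (n + 1) (f (n + 1) u)"
      by simp
  next
    assume "c \<oplus>\<^bsub>chains X' n\<^esub> dpos X' (n + 1) (f (n + 1) u)
            \<oplus>\<^bsub>chains X' n\<^esub> dneg X' (n + 1) (f (n + 1) v)
        = c' \<oplus>\<^bsub>chains X' n\<^esub> dpos X' (n + 1) (f (n + 1) v)
            \<oplus>\<^bsub>chains X' n\<^esub> dneg X' (n + 1) (f (n + 1) u)"
    from X'.ch.exchange_differentials[OF cancel[OF can] _ _ _ _ _ _ _ _ _ _ eq' eq' this]
    show "c \<oplus>\<^bsub>chains X' n\<^esub> f n (dpos X (n + 1) u) \<oplus>\<^bsub>chains X' n\<^esub> f n (dneg X (n + 1) v)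
        = c' \<oplus>\<^bsub>chains X' n\<^esub> f n (dpos X (n + 1) v) \<oplus>\<^bsub>chains X' n\<^esub> f n (dneg X (n + 1) u)"
      by simp
  qed
qed

lemma homology_map_defined: "homology_map_defined X X' f n"
proof (rule homology_map_definedI)
  show "f n x \<in> cycles X' n" if "x \<in> cycles X n" for x
    using that map_cycle_iff[of x n] by (simp add: cycles_def)
next
  fix x y u v
  assume x: "x \<in> cycles X n" "y \<in> cycles X n"
    and uv: "u \<in> carrier (chains X (n + 1))" "v \<in> carrier (chains X (n + 1))"
    and eq: "x \<oplus>\<^bsub>chains X n\<^esub> dpos X (n + 1) u \<oplus>\<^bsub>chains X n\<^esub> dneg X (n + 1) v =
        y \<oplus>\<^bsub>chains X n\<^esub> dpos X (n + 1) v \<oplus>\<^bsub>chains X n\<^esub> dneg X (n + 1) u"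
  show "f n x \<oplus>\<^bsub>chains X' n\<^esub> dpos X' (n + 1) (f (n + 1) u)
          \<oplus>\<^bsub>chains X' n\<^esub> dneg X' (n + 1) (f (n + 1) v) =
        f n y \<oplus>\<^bsub>chains X' n\<^esub> dpos X' (n + 1) (f (n + 1) v)
          \<oplus>\<^bsub>chains X' n\<^esub> dneg X' (n + 1) (f (n + 1) u)"
    using arg_cong[OF eq, of "f n"] x uv
    by (simp add: map_boundary_iff X.cycle_closed)
qed

end

section \<open>Group completion\<close>

definition square_semimodule :: "('r, 'a) module \<Rightarrow> ('r, 'a \<times> 'a) module" where
  "square_semimodule A = \<lparr>
    carrier = carrier A \<times> carrier A,
    monoid.mult = undefined,
    one = undefined,
    zero = (\<zero>\<^bsub>A\<^esub>, \<zero>\<^bsub>A\<^esub>),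
    add = (\<lambda>p q. (fst p \<oplus>\<^bsub>A\<^esub> fst q, snd p \<oplus>\<^bsub>A\<^esub> snd q)),
    smult = (\<lambda>r p. (r \<odot>\<^bsub>A\<^esub> fst p, r \<odot>\<^bsub>A\<^esub> snd p)) \<rparr>"

lemma square_semimodule_simps [simp]:
  "carrier (square_semimodule A) = carrier A \<times> carrier A"
  "\<zero>\<^bsub>square_semimodule A\<^esub> = (\<zero>\<^bsub>A\<^esub>, \<zero>\<^bsub>A\<^esub>)"
  "(a, b) \<oplus>\<^bsub>square_semimodule A\<^esub> (c, e) = (a \<oplus>\<^bsub>A\<^esub> c, b \<oplus>\<^bsub>A\<^esub> e)"
  "r \<odot>\<^bsub>square_semimodule A\<^esub> (a, b) = (r \<odot>\<^bsub>A\<^esub> a, r \<odot>\<^bsub>A\<^esub> b)"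
  by (simp_all add: square_semimodule_def)

lemma completion_relI:
  assumes "u \<in> carrier A" "v \<in> carrier A" "x \<in> carrier A" "y \<in> carrier A" "z \<in> carrier A"
    and "u \<oplus>\<^bsub>A\<^esub> y \<oplus>\<^bsub>A\<^esub> z = v \<oplus>\<^bsub>A\<^esub> x \<oplus>\<^bsub>A\<^esub> z"
  shows "((u, v), (x, y)) \<in> completion_rel A"
  using assms by (auto simp: completion_rel_def)

locale semimodule_completion = semimodule R A
  for R :: "('r, 'm) ring_scheme" (structure) and A :: "('r, 'a) module" (structure)
begin

declare smult_closed [simp]

lemma semimodule_square: "semimodule R (square_semimodule A)"
proof -
  have "abelian_monoid (square_semimodule A)"
    by (rule abelian_monoidI) (auto simp: M.a_ac)
  then show ?thesis
    using semiring_axioms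
    by (auto simp: semimodule_def semimodule_axioms_def smult_l_distr smult_r_distr
        smult_assoc1 smult_one smult_zero)
qed

text \<open>
  The middle pair cannot be cancelled; it becomes part of the new witness.
\<close>

lemma completion_rel_trans:
  assumes "((u, v), (x, y)) \<in> completion_rel A" "((x, y), (s, t)) \<in> completion_rel A"
  shows "((u, v), (s, t)) \<in> completion_rel A"
proof -
  from assms obtain z w where
    [simp]: "u \<in> carrier A" "v \<in> carrier A" "x \<in> carrier A" "y \<in> carrier A"
      "s \<in> carrier A" "t \<in> carrier A" "z \<in> carrier A" "w \<in> carrier A"
    and z: "u \<oplus>\<^bsub>A\<^esub> y \<oplus>\<^bsub>A\<^esub> z = v \<oplus>\<^bsub>A\<^esub> x \<oplus>\<^bsub>A\<^esub> z"
    and w: "x \<oplus>\<^bsub>A\<^esub> t \<oplus>\<^bsub>A\<^esub> w = y \<oplus>\<^bsub>A\<^esub> s \<oplus>\<^bsub>A\<^esub> w"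
    by (auto simp: completion_rel_def)
  have "u \<oplus>\<^bsub>A\<^esub> t \<oplus>\<^bsub>A\<^esub> (x \<oplus>\<^bsub>A\<^esub> y \<oplus>\<^bsub>A\<^esub> z \<oplus>\<^bsub>A\<^esub> w)
      = (u \<oplus>\<^bsub>A\<^esub> y \<oplus>\<^bsub>A\<^esub> z) \<oplus>\<^bsub>A\<^esub> (x \<oplus>\<^bsub>A\<^esub> t \<oplus>\<^bsub>A\<^esub> w)"
    by (simp add: M.a_ac)
  also have "\<dots> = v \<oplus>\<^bsub>A\<^esub> s \<oplus>\<^bsub>A\<^esub> (x \<oplus>\<^bsub>A\<^esub> y \<oplus>\<^bsub>A\<^esub> z \<oplus>\<^bsub>A\<^esub> w)"
    unfolding z w by (simp add: M.a_ac)
  finally show ?thesis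
    by (rule completion_relI[rotated 5]) simp_all
qed

lemma completion_rel_add:
  assumes "((u, v), (x, y)) \<in> completion_rel A" "((u', v'), (x', y')) \<in> completion_rel A"
  shows "((u \<oplus>\<^bsub>A\<^esub> u', v \<oplus>\<^bsub>A\<^esub> v'), (x \<oplus>\<^bsub>A\<^esub> x', y \<oplus>\<^bsub>A\<^esub> y')) \<in> completion_rel A"
proof -
  from assms obtain z w where
    [simp]: "u \<in> carrier A" "v \<in> carrier A" "x \<in> carrier A" "y \<in> carrier A"
      "u' \<in> carrier A" "v' \<in> carrier A" "x' \<in> carrier A" "y' \<in> carrier A"
      "z \<in> carrier A" "w \<in> carrier A"
    and z: "u \<oplus>\<^bsub>A\<^esub> y \<oplus>\<^bsub>A\<^esub> z = v \<oplus>\<^bsub>A\<^esub> x \<oplus>\<^bsub>A\<^esub> z"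
    and w: "u' \<oplus>\<^bsub>A\<^esub> y' \<oplus>\<^bsub>A\<^esub> w = v' \<oplus>\<^bsub>A\<^esub> x' \<oplus>\<^bsub>A\<^esub> w"
    by (auto simp: completion_rel_def)
  show ?thesis
    by (rule completion_relI[of _ _ _ _ _ "z \<oplus>\<^bsub>A\<^esub> w"]) (simp_all add: M.sum_of_triples z w)
qed

lemma completion_rel_smult:
  assumes "r \<in> carrier R" "((u, v), (x, y)) \<in> completion_rel A"
  shows "((r \<odot>\<^bsub>A\<^esub> u, r \<odot>\<^bsub>A\<^esub> v), (r \<odot>\<^bsub>A\<^esub> x, r \<odot>\<^bsub>A\<^esub> y)) \<in> completion_rel A"
proof -
  from assms obtain z where z: "u \<in> carrier A" "v \<in> carrier A" "x \<in> carrier A" "y \<in> carrier A"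
      "z \<in> carrier A" "u \<oplus>\<^bsub>A\<^esub> y \<oplus>\<^bsub>A\<^esub> z = v \<oplus>\<^bsub>A\<^esub> x \<oplus>\<^bsub>A\<^esub> z"
    by (auto simp: completion_rel_def)
  show ?thesis
    by (rule completion_relI[of _ _ _ _ _ "r \<odot>\<^bsub>A\<^esub> z"])
      (use z assms(1) in \<open>simp_all flip: smult_r_distr\<close>)
qed

lemma completion_congruence:
  "semimodule_congruence R (square_semimodule A) (completion_rel A)"
proof -
  interpret sq: semimodule R "square_semimodule A" by (rule semimodule_square)
  have "refl_on (carrier A \<times> carrier A) (completion_rel A)"
    by (rule refl_onI) (auto intro!: completion_relI[of _ _ _ _ _ "\<zero>\<^bsub>A\<^esub>"] simp: M.a_comm)
  moreover have "completion_rel A \<subseteq> (carrier A \<times> carrier A) \<times> (carrier A \<times> carrier A)"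
    by (auto simp: completion_rel_def)
  moreover have "sym (completion_rel A)"
  proof (rule symI, clarify)
    fix u v x y assume "((u, v), (x, y)) \<in> completion_rel A"
    then obtain z where z: "u \<in> carrier A" "v \<in> carrier A" "x \<in> carrier A" "y \<in> carrier A"
        "z \<in> carrier A" "u \<oplus>\<^bsub>A\<^esub> y \<oplus>\<^bsub>A\<^esub> z = v \<oplus>\<^bsub>A\<^esub> x \<oplus>\<^bsub>A\<^esub> z"
      by (auto simp: completion_rel_def)
    show "((x, y), (u, v)) \<in> completion_rel A"
      by (rule completion_relI[of _ _ _ _ _ z]) (use z(1-5) z(6)[symmetric] in \<open>simp_all add: M.a_comm\<close>)
  qed
  moreover have "trans (completion_rel A)"
    by (rule transI) (auto intro: completion_rel_trans)
  ultimately have "equiv (carrier (square_semimodule A)) (completion_rel A)"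
    by (simp add: equiv_def)
  then show ?thesis
    by unfold_locales (auto intro: completion_rel_add completion_rel_smult)
qed

lemma completion_quotient:
  "completion A = quotient_semimodule (square_semimodule A) (completion_rel A)"
  by (simp add: completion_def quotient_semimodule_def square_semimodule_def
      completion_class_def case_prod_unfold)

lemma semimodule_completion: "semimodule R (completion A)"
  unfolding completion_quotient
  by (rule semimodule_congruence.semimodule_quotient[OF completion_congruence])

lemma cclass_eq_iff:
  assumes "u \<in> carrier A" "v \<in> carrier A" "x \<in> carrier A" "y \<in> carrier A"
  shows "completion_class A (u, v) = completion_class A (x, y) \<longleftrightarrow>
    (\<exists>z\<in>carrier A. u \<oplus>\<^bsub>A\<^esub> y \<oplus>\<^bsub>A\<^esub> z = v \<oplus>\<^bsub>A\<^esub> x \<oplus>\<^bsub>A\<^esub> z)"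
  using semimodule_congruence.class_eq_iff[OF completion_congruence, of "(u, v)" "(x, y)"] assms
  by (simp add: completion_class_def completion_rel_def)

lemma cclass_eqI:
  assumes "u \<in> carrier A" "v \<in> carrier A" "x \<in> carrier A" "y \<in> carrier A"
    and "u \<oplus>\<^bsub>A\<^esub> y = v \<oplus>\<^bsub>A\<^esub> x"
  shows "completion_class A (u, v) = completion_class A (x, y)"
  using assms by (auto simp: cclass_eq_iff)

lemma cclass_closed [simp]:
  "u \<in> carrier A \<Longrightarrow> v \<in> carrier A \<Longrightarrow> completion_class A (u, v) \<in> carrier (completion A)"
  using semimodule_congruence.class_closed[OF completion_congruence, of "(u, v)"]
  by (simp add: completion_class_def completion_quotient)

lemma completionE:
  assumes "U \<in> carrier (completion A)"
  obtains u v where "u \<in> carrier A" "v \<in> carrier A" "U = completion_class A (u, v)"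
proof -
  from assms obtain p where "p \<in> carrier (square_semimodule A)" "U = completion_rel A `` {p}"
    unfolding completion_quotient by (rule semimodule_congruence.classE[OF completion_congruence])
  then show thesis
    by (intro that[of "fst p" "snd p"]) (auto simp: completion_class_def)
qed

lemma completion_zero: "\<zero>\<^bsub>completion A\<^esub> = completion_class A (\<zero>\<^bsub>A\<^esub>, \<zero>\<^bsub>A\<^esub>)"
  by (simp add: completion_def)

lemma cclass_add [simp]:
  "\<lbrakk>u \<in> carrier A; v \<in> carrier A; x \<in> carrier A; y \<in> carrier A\<rbrakk> \<Longrightarrow>
    completion_class A (u, v) \<oplus>\<^bsub>completion A\<^esub> completion_class A (x, y) =
    completion_class A (u \<oplus>\<^bsub>A\<^esub> x, v \<oplus>\<^bsub>A\<^esub> y)"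
  using semimodule_congruence.class_add[OF completion_congruence, of "(u, v)" "(x, y)"]
  by (simp add: completion_class_def completion_quotient)

lemma cclass_smult [simp]:
  "\<lbrakk>r \<in> carrier R; u \<in> carrier A; v \<in> carrier A\<rbrakk> \<Longrightarrow>
    r \<odot>\<^bsub>completion A\<^esub> completion_class A (u, v) = completion_class A (r \<odot>\<^bsub>A\<^esub> u, r \<odot>\<^bsub>A\<^esub> v)"
  using semimodule_congruence.class_smult[OF completion_congruence, of r "(u, v)"]
  by (simp add: completion_class_def completion_quotient)

lemma cclass_opposite:
  "u \<in> carrier A \<Longrightarrow> v \<in> carrier A \<Longrightarrow>
    completion_class A (v, u) \<oplus>\<^bsub>completion A\<^esub> completion_class A (u, v) = \<zero>\<^bsub>completion A\<^esub>"
  by (simp add: completion_zero) (rule cclass_eqI, simp_all add: M.a_comm)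

lemma abelian_group_completion: "abelian_group (completion A)"
proof -
  interpret K: semimodule R "completion A" by (rule semimodule_completion)
  show ?thesis
  proof (rule abelian_groupI)
    fix U assume "U \<in> carrier (completion A)"
    then show "\<exists>V\<in>carrier (completion A). V \<oplus>\<^bsub>completion A\<^esub> U = \<zero>\<^bsub>completion A\<^esub>"
      by (metis completionE cclass_opposite cclass_closed)
  qed (simp_all add: K.M.a_ac)
qed

lemma cclass_minus:
  assumes [simp]: "u \<in> carrier A" "v \<in> carrier A" "x \<in> carrier A" "y \<in> carrier A"
  shows "completion_class A (u, v) \<ominus>\<^bsub>completion A\<^esub> completion_class A (x, y) =
    completion_class A (u \<oplus>\<^bsub>A\<^esub> y, v \<oplus>\<^bsub>A\<^esub> x)"
proof -
  interpret K: abelian_group "completion A" by (rule abelian_group_completion)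
  have "\<ominus>\<^bsub>completion A\<^esub> completion_class A (x, y) = completion_class A (y, x)"
    by (rule K.minus_equality) (simp_all add: cclass_opposite del: cclass_add)
  then show ?thesis by (simp add: a_minus_def)
qed

lemma completion_unit_hom: "semimodule_hom R A (completion A) (completion_unit A)"
  by (rule semimodule_homI[OF semimodule_axioms semimodule_completion])
    (simp_all add: completion_unit_def smult_r_zero)

end

lemma
  assumes A: "semimodule_completion R A" and B: "semimodule_completion R B"
    and f: "semimodule_hom R A B f"
  shows completion_map_cclass:
      "\<And>u v. u \<in> carrier A \<Longrightarrow> v \<in> carrier A \<Longrightarrow>
        completion_map B f (completion_class A (u, v)) = completion_class B (f u, f v)"
    and completion_map_hom:
      "semimodule_hom R (completion A) (completion B) (completion_map B f)"
proof -
  interpret A: semimodule_completion R A by fact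
  interpret B: semimodule_completion R B by fact
  interpret f: semimodule_hom R A B f by fact
  have hom: "semimodule_hom R (square_semimodule A) (square_semimodule B) (map_prod f f)"
    by (rule semimodule_homI[OF A.semimodule_square B.semimodule_square])
      (auto simp: f.hom_closed f.hom_add f.hom_smult)
  have rel: "(map_prod f f p, map_prod f f q) \<in> completion_rel B"
    if "(p, q) \<in> completion_rel A" for p q
  proof -
    obtain u v x y where pq: "p = (u, v)" "q = (x, y)" by (metis surj_pair)
    with that obtain z where z: "u \<in> carrier A" "v \<in> carrier A" "x \<in> carrier A" "y \<in> carrier A"
        "z \<in> carrier A" "u \<oplus>\<^bsub>A\<^esub> y \<oplus>\<^bsub>A\<^esub> z = v \<oplus>\<^bsub>A\<^esub> x \<oplus>\<^bsub>A\<^esub> z"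
      by (auto simp: completion_rel_def)
    show ?thesis
      using z(1-5) arg_cong[OF z(6), of f] unfolding pq
      by (auto intro!: completion_relI[of _ _ _ _ _ "f z"] simp: f.hom_closed f.hom_add)
  qed
  have ind: "completion_map B f = induced_map (completion_rel B) (map_prod f f)"
    by (auto simp: fun_eq_iff completion_map_def induced_map_def completion_class_def
        case_prod_unfold map_prod_def)
  note * = A.completion_congruence B.completion_congruence hom rel
  show "completion_map B f (completion_class A (u, v)) = completion_class B (f u, f v)"
    if "u \<in> carrier A" "v \<in> carrier A" for u v
    using induced_map_class[OF *, of "(u, v)"] that by (simp add: ind completion_class_def)
  show "semimodule_hom R (completion A) (completion B) (completion_map B f)"
    using induced_map_hom[OF *] by (simp add: ind A.completion_quotient B.completion_quotient)
qed

lemma completion_complex_simps [simp]: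
  "chains (completion_complex X) n = completion (chains X n)"
  "dneg (completion_complex X) n U = \<zero>\<^bsub>completion (chains X (n - 1))\<^esub>"
  by (simp_all add: completion_complex_def ordinary_def)

context semimodule_complex
begin

sublocale K: semimodule_completion R "chains X n" for n
  by unfold_locales

lemma completion_diff_cclass [simp]:
  assumes "x \<in> carrier (chains X n)" "y \<in> carrier (chains X n)"
  shows "dpos (completion_complex X) n (completion_class (chains X n) (x, y)) =
    completion_class (chains X (n - 1))
      (dpos X n x \<oplus>\<^bsub>chains X (n - 1)\<^esub> dneg X n y, dpos X n y \<oplus>\<^bsub>chains X (n - 1)\<^esub> dneg X n x)"
  using assms
  by (simp add: completion_complex_def ordinary_def K.cclass_minus
      completion_map_cclass[OF K.semimodule_completion_axioms K.semimodule_completion_axioms dpos_hom]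
      completion_map_cclass[OF K.semimodule_completion_axioms K.semimodule_completion_axioms dneg_hom])

lemma completion_diff_hom:
  "semimodule_hom R (completion (chains X n)) (completion (chains X (n - 1)))
    (dpos (completion_complex X) n)"
proof (rule semimodule_homI[OF K.semimodule_completion K.semimodule_completion])
  let ?d = "dpos (completion_complex X) n"
  fix U assume "U \<in> carrier (completion (chains X n))"
  then obtain x y where U: "x \<in> carrier (chains X n)" "y \<in> carrier (chains X n)"
    "U = completion_class (chains X n) (x, y)" by (rule K.completionE)
  then show "?d U \<in> carrier (completion (chains X (n - 1)))" by simp
  show "?d (r \<odot>\<^bsub>completion (chains X n)\<^esub> U) = r \<odot>\<^bsub>completion (chains X (n - 1))\<^esub> ?d U"
    if "r \<in> carrier R" for r
    using U that by (simp add: ch.smult_r_distr)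
  fix V assume "V \<in> carrier (completion (chains X n))"
  then obtain s t where V: "s \<in> carrier (chains X n)" "t \<in> carrier (chains X n)"
    "V = completion_class (chains X n) (s, t)" by (rule K.completionE)
  show "?d (U \<oplus>\<^bsub>completion (chains X n)\<^esub> V) = ?d U \<oplus>\<^bsub>completion (chains X (n - 1))\<^esub> ?d V"
    using U V by (simp add: ch.a_ac)
qed

lemma completion_zero_hom:
  "semimodule_hom R (completion (chains X n)) (completion (chains X (n - 1)))
    (dneg (completion_complex X) n)"
proof -
  interpret N: semimodule R "completion (chains X (n - 1))" by (rule K.semimodule_completion)
  show ?thesis
    by (rule semimodule_homI[OF K.semimodule_completion K.semimodule_completion])
      (simp_all add: N.smult_r_zero)
qed

lemma completion_diff_diff:
  assumes "U \<in> carrier (completion (chains X (n + 1)))"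
  shows "dpos (completion_complex X) n (dpos (completion_complex X) (n + 1) U) =
    \<zero>\<^bsub>completion (chains X (n - 1))\<^esub>"
proof -
  from assms obtain x y where xy [simp]:
    "x \<in> carrier (chains X (n + 1))" "y \<in> carrier (chains X (n + 1))"
    and U: "U = completion_class (chains X (n + 1)) (x, y)" by (rule K.completionE)
  let ?p = "dpos X n" and ?m = "dneg X n" and ?p' = "dpos X (n + 1)" and ?m' = "dneg X (n + 1)"
  let ?C = "chains X (n - 1)"
  have "?p (?p' x) \<oplus>\<^bsub>?C\<^esub> ?p (?m' y) \<oplus>\<^bsub>?C\<^esub> (?m (?p' y) \<oplus>\<^bsub>?C\<^esub> ?m (?m' x))
      = (?p (?p' x) \<oplus>\<^bsub>?C\<^esub> ?m (?m' x)) \<oplus>\<^bsub>?C\<^esub> (?p (?m' y) \<oplus>\<^bsub>?C\<^esub> ?m (?p' y))"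
    by (simp add: ch.a_ac)
  also have "\<dots> = ?p (?p' y) \<oplus>\<^bsub>?C\<^esub> ?p (?m' x) \<oplus>\<^bsub>?C\<^esub> (?m (?p' x) \<oplus>\<^bsub>?C\<^esub> ?m (?m' y))"
    unfolding diff_diff[OF xy(1)] diff_diff[OF xy(2), symmetric] by (simp add: ch.a_ac)
  finally show ?thesis
    unfolding U by (simp add: K.completion_zero) (rule K.cclass_eqI, simp_all)
qed

lemma completion_complex: "chain_complex R (completion_complex X)"
proof -
  have "dpos (completion_complex X) n \<zero>\<^bsub>completion (chains X n)\<^esub> =
      \<zero>\<^bsub>completion (chains X (n - 1))\<^esub>" for n
    by (rule semimodule_hom.hom_zero[OF completion_diff_hom])
  moreover have "abelian_monoid (completion (chains X n))" for n
    using K.semimodule_completion by (simp add: semimodule_def)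
  ultimately show ?thesis
    using completion_diff_hom completion_zero_hom
    by (simp add: chain_complex_def completion_diff_diff abelian_monoid.l_zero
        abelian_monoid.zero_closed)
qed

end

section \<open>Complexes of modules and the snake\<close>

locale module_complex = semimodule_complex +
  assumes chains_group: "abelian_group (chains X n)"
    and dneg_eq_zero [simp]: "dneg X n x = \<zero>\<^bsub>chains X (n - 1)\<^esub>"
begin

sublocale grp: abelian_group "chains X n" for n
  by (rule chains_group)

lemma module_diff_diff:
  "x \<in> carrier (chains X (n + 1)) \<Longrightarrow> dpos X n (dpos X (n + 1) x) = \<zero>\<^bsub>chains X (n - 1)\<^esub>"
  using diff_diff[of x n] diff_zero(1)[of n] by simp

text \<open>
  When subtraction is available the two chains \<open>u\<close>, \<open>v\<close> of a homology combine to the single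
  chain \<open>v - u\<close>.
\<close>

lemma module_homologous_iff:
  assumes xy [simp]: "x \<in> cycles X n" "y \<in> cycles X n"
  shows "(x, y) \<in> homology_rel X n \<longleftrightarrow>
    (\<exists>w\<in>carrier (chains X (n + 1)). x = dpos X (n + 1) w \<oplus>\<^bsub>chains X n\<^esub> y)"
proof
  note [simp] = xy[THEN cycle_closed]
  assume "(x, y) \<in> homology_rel X n"
  then obtain u v where uv [simp]: "u \<in> carrier (chains X (n + 1))" "v \<in> carrier (chains X (n + 1))"
    and "x \<oplus>\<^bsub>chains X n\<^esub> dpos X (n + 1) u \<oplus>\<^bsub>chains X n\<^esub> dneg X (n + 1) v =
      y \<oplus>\<^bsub>chains X n\<^esub> dpos X (n + 1) v \<oplus>\<^bsub>chains X n\<^esub> dneg X (n + 1) u"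
    by (rule homology_relE)
  then have eq: "x \<oplus>\<^bsub>chains X n\<^esub> dpos X (n + 1) u = y \<oplus>\<^bsub>chains X n\<^esub> dpos X (n + 1) v"
    by simp
  let ?w = "\<ominus>\<^bsub>chains X (n + 1)\<^esub> u"
  have "dpos X (n + 1) u \<oplus>\<^bsub>chains X n\<^esub> dpos X (n + 1) ?w = \<zero>\<^bsub>chains X n\<^esub>"
    using diff_add(1)[of u "n + 1" ?w] diff_zero(1)[of "n + 1"] by (simp add: grp.r_neg)
  then have "x = (x \<oplus>\<^bsub>chains X n\<^esub> dpos X (n + 1) u) \<oplus>\<^bsub>chains X n\<^esub> dpos X (n + 1) ?w"
    by (simp add: ch.a_assoc)
  also have "\<dots> = dpos X (n + 1) (v \<oplus>\<^bsub>chains X (n + 1)\<^esub> ?w) \<oplus>\<^bsub>chains X n\<^esub> y"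
    unfolding eq by (simp add: ch.a_ac)
  finally show "\<exists>w\<in>carrier (chains X (n + 1)). x = dpos X (n + 1) w \<oplus>\<^bsub>chains X n\<^esub> y"
    by (rule bexI) simp
next
  note [simp] = xy[THEN cycle_closed]
  assume "\<exists>w\<in>carrier (chains X (n + 1)). x = dpos X (n + 1) w \<oplus>\<^bsub>chains X n\<^esub> y"
  then obtain w where w: "w \<in> carrier (chains X (n + 1))" "x = dpos X (n + 1) w \<oplus>\<^bsub>chains X n\<^esub> y"
    by blast
  then show "(x, y) \<in> homology_rel X n"
    by (intro homology_relI[OF xy ch.zero_closed w(1)]) (simp_all add: ch.a_comm)
qed

end

lemma (in semimodule_complex) module_complex_completion: "module_complex R (completion_complex X)"
  by (intro module_complex.intro semimodule_complex.intro module_complex_axioms.intro)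
    (simp_all add: completion_complex K.abelian_group_completion)

text \<open>
  The snake construction is well defined: the class of \<open>a\<close> depends neither on the lift \<open>b\<close> nor
  on the representative of the homology class.  If \<open>g b\<close> and \<open>g b'\<close> differ by \<open>\<partial> (g x)\<close>, then \<open>b\<close>
  and \<open>\<partial> x + b'\<close> lie in one fibre of \<open>g\<close>, hence differ by some \<open>f e\<close>, and \<open>a\<close> and \<open>a'\<close> differ by
  \<open>\<partial> e\<close>.  Exactness in the middle is phrased as transitivity on the fibres of \<open>g\<close>, the form in
  which it is inherited from a Schreier extension.
\<close>

lemma connecting_hom_hclass:
  assumes A: "module_complex R A" and B: "module_complex R B" and C: "module_complex R C"
    and f: "semimodule_complex_maps R A B f" and g: "semimodule_complex_maps R B C g"
    and f_diff: "\<And>n x. x \<in> carrier (chains A n) \<Longrightarrow> dpos B n (f n x) = f (n - 1) (dpos A n x)"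
    and g_diff: "\<And>n x. x \<in> carrier (chains B n) \<Longrightarrow> dpos C n (g n x) = g (n - 1) (dpos B n x)"
    and f_inj: "\<And>n. inj_on (f n) (carrier (chains A n))"
    and g_surj: "\<And>n. g n ` carrier (chains B n) = carrier (chains C n)"
    and fibre: "\<And>n b b'. b \<in> carrier (chains B n) \<Longrightarrow> b' \<in> carrier (chains B n) \<Longrightarrow>
      g n b = g n b' \<Longrightarrow> \<exists>e\<in>carrier (chains A n). b = f n e \<oplus>\<^bsub>chains B n\<^esub> b'"
    and b: "b \<in> carrier (chains B n)" and gb: "g n b \<in> cycles C n"
    and a: "a \<in> cycles A (n - 1)" and fa: "f (n - 1) a = dpos B n b"
  shows "connecting_hom A B f g n (hclass C n (g n b)) = hclass A (n - 1) a"
proof -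
  interpret A: module_complex R A by fact
  interpret B: module_complex R B by fact
  interpret C: module_complex R C by fact
  interpret f: semimodule_complex_maps R A B f by fact
  interpret g: semimodule_complex_maps R B C g by fact
  have unique: "hclass A (n - 1) a = hclass A (n - 1) a'"
    if c': "g n b' \<in> hclass C n (g n b)" and b': "b' \<in> carrier (chains B n)"
      and a': "a' \<in> cycles A (n - 1)" and fa': "f (n - 1) a' = dpos B n b'" for a' b'
  proof -
    note [simp] = b b' a[THEN A.cycle_closed] a'[THEN A.cycle_closed]
    have rel: "(g n b, g n b') \<in> homology_rel C n"
      using c' by (simp add: hclass_def)
    then have "g n b' \<in> cycles C n" by (rule C.homology_relE)
    then obtain w where w: "w \<in> carrier (chains C (n + 1))"
      "g n b = dpos C (n + 1) w \<oplus>\<^bsub>chains C n\<^esub> g n b'"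
      using rel gb by (auto simp: C.module_homologous_iff)
    from w(1) g_surj obtain x where x [simp]: "x \<in> carrier (chains B (n + 1))" and wx: "w = g (n + 1) x"
      by (metis imageE)
    have "g n b = g n (dpos B (n + 1) x \<oplus>\<^bsub>chains B n\<^esub> b')"
      using w(2) g_diff[OF x] by (simp add: wx)
    then obtain e where e [simp]: "e \<in> carrier (chains A n)"
      and be: "b = f n e \<oplus>\<^bsub>chains B n\<^esub> (dpos B (n + 1) x \<oplus>\<^bsub>chains B n\<^esub> b')"
      using fibre[of b n "dpos B (n + 1) x \<oplus>\<^bsub>chains B n\<^esub> b'"] by auto
    have "f (n - 1) a = f (n - 1) (dpos A n e \<oplus>\<^bsub>chains A (n - 1)\<^esub> a')"
      using arg_cong[OF be, of "dpos B n"]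
      by (simp add: fa fa' f_diff B.module_diff_diff)
    then have "a = dpos A n e \<oplus>\<^bsub>chains A (n - 1)\<^esub> a'"
      by (rule inj_onD[OF f_inj]) simp_all
    then have "(a, a') \<in> homology_rel A (n - 1)"
      using a a' e by (auto simp: A.module_homologous_iff)
    then show ?thesis using a a' by (simp add: A.hclass_eq_iff)
  qed
  show ?thesis
    unfolding connecting_hom_def
  proof (rule the_equality)
    have "g n b \<in> hclass C n (g n b)"
      using C.hclass_eq_iff[OF gb gb] by (simp add: hclass_def)
    then show "\<exists>c\<in>hclass C n (g n b). \<exists>b\<in>carrier (chains B n). \<exists>a'\<in>cycles A (n - 1).
        g n b = c \<and> f (n - 1) a' = dpos B n b \<and> hclass A (n - 1) a = hclass A (n - 1) a'"
      using b a fa by blast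
  qed (use unique in blast)
qed

context semimodule_chain_morphism
begin

lemma completion_morphism_cclass [simp]:
  "x \<in> carrier (chains X n) \<Longrightarrow> y \<in> carrier (chains X n) \<Longrightarrow>
    completion_morphism X' f n (completion_class (chains X n) (x, y)) =
    completion_class (chains X' n) (f n x, f n y)"
  unfolding completion_morphism_def
  by (rule completion_map_cclass[OF X.K.semimodule_completion_axioms
        X'.K.semimodule_completion_axioms component_hom])

lemma completion_morphism_maps:
  "semimodule_complex_maps R (completion_complex X) (completion_complex X') (completion_morphism X' f)"
  by (intro semimodule_complex_maps.intro semimodule_complex.intro semimodule_complex_maps_axioms.intro)
    (simp_all add: X.completion_complex X'.completion_complex completion_morphism_def
      completion_map_hom[OF X.K.semimodule_completion_axioms
        X'.K.semimodule_completion_axioms component_hom])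

lemma completion_morphism_diff:
  assumes "U \<in> carrier (completion (chains X n))"
  shows "dpos (completion_complex X') n (completion_morphism X' f n U) =
    completion_morphism X' f (n - 1) (dpos (completion_complex X) n U)"
proof -
  from assms obtain x y where xy [simp]: "x \<in> carrier (chains X n)" "y \<in> carrier (chains X n)"
    and U: "U = completion_class (chains X n) (x, y)" by (rule X.K.completionE)
  let ?p = "dpos X n" and ?m = "dneg X n" and ?p' = "dpos X' n" and ?m' = "dneg X' n"
  let ?C = "chains X' (n - 1)" and ?f = "f (n - 1)"
  have "?p' (f n x) \<oplus>\<^bsub>?C\<^esub> ?m' (f n y) \<oplus>\<^bsub>?C\<^esub> (?f (?p y) \<oplus>\<^bsub>?C\<^esub> ?f (?m x))
      = (?p' (f n x) \<oplus>\<^bsub>?C\<^esub> ?f (?m x)) \<oplus>\<^bsub>?C\<^esub> (?m' (f n y) \<oplus>\<^bsub>?C\<^esub> ?f (?p y))"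
    by (simp add: X'.ch.a_ac)
  also have "\<dots> = ?p' (f n y) \<oplus>\<^bsub>?C\<^esub> ?m' (f n x) \<oplus>\<^bsub>?C\<^esub> (?f (?p x) \<oplus>\<^bsub>?C\<^esub> ?f (?m y))"
    unfolding diff_map[OF xy(1)] diff_map[OF xy(2), symmetric] by (simp add: X'.ch.a_ac)
  finally show ?thesis
    unfolding U by simp (rule X'.K.cclass_eqI, simp_all)
qed

end

lemma abelian_group_cancellative:
  assumes "abelian_group A" shows "cancellative A"
proof -
  interpret abelian_group A by fact
  show ?thesis unfolding cancellative_def by (metis add.right_cancel a_comm)
qed

context semimodule_complex
begin

text \<open>
  Groups are cancellative, so passing to the completion falls under the cancellative
  alternative and induces a map on homology.
\<close>

lemma complex_unit_morphism: "strong_chain_morphism R X (completion_complex X) (complex_unit X)"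
proof -
  interpret KX: module_complex R "completion_complex X" by (rule module_complex_completion)
  have hom: "semimodule_hom R (chains X n) (chains (completion_complex X) n) (complex_unit X n)" for n
    unfolding complex_unit_def completion_complex_simps by (rule K.completion_unit_hom)
  have "dpos (completion_complex X) n (complex_unit X n x)
        \<oplus>\<^bsub>completion (chains X (n - 1))\<^esub> complex_unit X (n - 1) (dneg X n x)
      = dneg (completion_complex X) n (complex_unit X n x)
        \<oplus>\<^bsub>completion (chains X (n - 1))\<^esub> complex_unit X (n - 1) (dpos X n x)"
    if "x \<in> carrier (chains X n)" for n x
    using that
    by (simp add: complex_unit_def completion_unit_def K.completion_zero)
      (rule K.cclass_eqI, simp_all add: ch.a_comm)
  then have "chain_morphism R X (completion_complex X) (complex_unit X)"
    using hom by (simp add: chain_morphism_def)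
  moreover have "cancellative (chains (completion_complex X) n)" for n
    by (rule abelian_group_cancellative) (rule KX.chains_group)
  ultimately show ?thesis
    by (intro strong_chain_morphism.intro semimodule_chain_morphism.intro
        semimodule_complex_maps.intro semimodule_complex_maps_axioms.intro
        semimodule_chain_morphism_axioms.intro strong_chain_morphism_axioms.intro
        semimodule_complex_axioms KX.semimodule_complex_axioms hom disjI2 allI)
qed

lemma homology_unit_hclass:
  "x \<in> cycles X n \<Longrightarrow> homology_map (completion_complex X) (complex_unit X) n (hclass X n x) =
    hclass (completion_complex X) n (completion_class (chains X n) (x, \<zero>\<^bsub>chains X n\<^esub>))"
proof -
  interpret k: strong_chain_morphism R X "completion_complex X" "complex_unit X"
    by (rule complex_unit_morphism)
  assume "x \<in> cycles X n"
  then show ?thesis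
    by (simp add: k.homology_map_hclass[OF k.homology_map_defined])
      (simp add: complex_unit_def completion_unit_def)
qed

lemma unit_cycle:
  "x \<in> cycles X n \<Longrightarrow>
    completion_class (chains X n) (x, \<zero>\<^bsub>chains X n\<^esub>) \<in> cycles (completion_complex X) n"
  by (simp add: cycles_def K.completion_zero) (rule K.cclass_eqI, simp_all add: ch.a_comm)

end

text \<open>
  This makes the identification of the homology of a complex of modules with that of its
  completion invertible on the classes that come from the complex itself, which suffices to
  evaluate the connecting homomorphism of the completed sequence.
\<close>

lemma (in module_complex) inj_on_homology_unit:
  "inj_on (homology_map (completion_complex X) (complex_unit X) n) (carrier (homology X n))"
proof (rule inj_onI)
  interpret KX: module_complex R "completion_complex X" by (rule module_complex_completion)
  fix U V
  assume UV: "U \<in> carrier (homology X n)" "V \<in> carrier (homology X n)"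
    and eq: "homology_map (completion_complex X) (complex_unit X) n U =
      homology_map (completion_complex X) (complex_unit X) n V"
  from UV obtain x y where x: "x \<in> cycles X n" "U = hclass X n x"
    and y: "y \<in> cycles X n" "V = hclass X n y"
    by (metis homologyE)
  note [simp] = x(1)[THEN cycle_closed] y(1)[THEN cycle_closed]
  let ?z = "\<zero>\<^bsub>chains X n\<^esub>"
  obtain W where W: "W \<in> carrier (completion (chains X (n + 1)))"
    "completion_class (chains X n) (x, ?z) = dpos (completion_complex X) (n + 1) W
      \<oplus>\<^bsub>completion (chains X n)\<^esub> completion_class (chains X n) (y, ?z)"
    using eq x y unit_cycle
    by (auto simp: homology_unit_hclass KX.hclass_eq_iff KX.module_homologous_iff)
  from W(1) obtain u v where uv [simp]: "u \<in> carrier (chains X (n + 1))" "v \<in> carrier (chains X (n + 1))"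
    and "W = completion_class (chains X (n + 1)) (u, v)"
    by (rule K.completionE)
  with W(2) obtain z where z [simp]: "z \<in> carrier (chains X n)"
    and "x \<oplus>\<^bsub>chains X n\<^esub> dpos X (n + 1) v \<oplus>\<^bsub>chains X n\<^esub> z =
      dpos X (n + 1) u \<oplus>\<^bsub>chains X n\<^esub> y \<oplus>\<^bsub>chains X n\<^esub> z"
    by (auto simp: K.cclass_eq_iff)
  then have "x \<oplus>\<^bsub>chains X n\<^esub> dpos X (n + 1) v = y \<oplus>\<^bsub>chains X n\<^esub> dpos X (n + 1) u"
    by (simp add: ch.a_comm)
  then have "(x, y) \<in> homology_rel X n"
    by (intro homology_relI[OF x(1) y(1) uv(2,1)]) simp
  then show "U = V" using x y by (simp add: hclass_eq_iff)
qed

section \<open>Extensions by complexes of modules\<close>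

context semimodule_complex
begin

text \<open>
  These are the pairs for which the formal difference \<open>[s, t]\<close> is a cycle of the completed
  complex, with the equation taken in \<open>X\<close> itself and so without an auxiliary summand.
\<close>

definition cycle_pair :: "int \<Rightarrow> 'a \<Rightarrow> 'a \<Rightarrow> bool" where
  "cycle_pair n s t \<longleftrightarrow> s \<in> carrier (chains X n) \<and> t \<in> carrier (chains X n) \<and>
    dpos X n s \<oplus>\<^bsub>chains X (n - 1)\<^esub> dneg X n t = dneg X n s \<oplus>\<^bsub>chains X (n - 1)\<^esub> dpos X n t"

lemma cycle_pair_sym: "cycle_pair n s t \<Longrightarrow> cycle_pair n t s"
  by (auto simp: cycle_pair_def ch.a_comm)

lemma cycle_pair_add:
  assumes "cycle_pair n s t" "cycle_pair n s' t'"
  shows "cycle_pair n (s \<oplus>\<^bsub>chains X n\<^esub> s') (t \<oplus>\<^bsub>chains X n\<^esub> t')"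
proof -
  have [simp]: "s \<in> carrier (chains X n)" "t \<in> carrier (chains X n)"
      "s' \<in> carrier (chains X n)" "t' \<in> carrier (chains X n)"
    and eq: "dpos X n s \<oplus>\<^bsub>chains X (n - 1)\<^esub> dneg X n t = dneg X n s \<oplus>\<^bsub>chains X (n - 1)\<^esub> dpos X n t"
    and eq': "dpos X n s' \<oplus>\<^bsub>chains X (n - 1)\<^esub> dneg X n t' = dneg X n s' \<oplus>\<^bsub>chains X (n - 1)\<^esub> dpos X n t'"
    using assms by (auto simp: cycle_pair_def)
  let ?C = "chains X (n - 1)" and ?p = "dpos X n" and ?m = "dneg X n"
  have "?p s \<oplus>\<^bsub>?C\<^esub> ?p s' \<oplus>\<^bsub>?C\<^esub> (?m t \<oplus>\<^bsub>?C\<^esub> ?m t')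
      = (?p s \<oplus>\<^bsub>?C\<^esub> ?m t) \<oplus>\<^bsub>?C\<^esub> (?p s' \<oplus>\<^bsub>?C\<^esub> ?m t')"
    by (simp add: ch.a_ac)
  also have "\<dots> = ?m s \<oplus>\<^bsub>?C\<^esub> ?m s' \<oplus>\<^bsub>?C\<^esub> (?p t \<oplus>\<^bsub>?C\<^esub> ?p t')"
    unfolding eq eq' by (simp add: ch.a_ac)
  finally show ?thesis by (simp add: cycle_pair_def)
qed

lemma cycle_pair_cycle: "s \<in> cycles X n \<Longrightarrow> cycle_pair n s \<zero>\<^bsub>chains X n\<^esub>"
  by (simp add: cycle_pair_def cycles_def)

lemma cycle_pair_diff:
  assumes u [simp]: "u \<in> carrier (chains X n)"
  shows "cycle_pair (n - 1) (dpos X n u) (dneg X n u)"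
proof -
  have "u \<in> carrier (chains X (n - 1 + 1))" by simp
  from diff_diff[OF this] show ?thesis
    by (simp add: cycle_pair_def ch.a_comm)
qed

end

text \<open>
  Because \<open>G\<close> consists of groups, every element of a fibre of \<open>\<sigma>\<close> is a representative: \<open>G\<close> acts on
  \<open>B\<close> through \<open>\<kappa>\<close>, freely and transitively on each fibre.  This replaces the subtraction that
  \<open>B\<close> and \<open>C\<close> lack.
\<close>

locale schreier_by_modules =
  G: module_complex R G + B: semimodule_complex R B + C: semimodule_complex R C +
  \<kappa>: semimodule_chain_morphism R G B \<kappa> + \<sigma>: strong_chain_morphism R B C \<sigma>
  for R :: "('r, 'm) ring_scheme" and G :: "('r, 'g) pm_complex" and B :: "('r, 'b) pm_complex"
    and C :: "('r, 'c) pm_complex" and \<kappa> \<sigma> +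
  assumes extension:
    "schreier_extension R (chains G n) (chains B n) (chains C n) (\<kappa> n) (\<sigma> n)"
begin

lemma \<sigma>_\<kappa> [simp]: "g \<in> carrier (chains G n) \<Longrightarrow> \<sigma> n (\<kappa> n g) = \<zero>\<^bsub>chains C n\<^esub>"
  using extension[of n] unfolding schreier_extension_def a_kernel_def' by blast

lemma \<sigma>_surj:
  assumes "c \<in> carrier (chains C n)"
  obtains b where "b \<in> carrier (chains B n)" "c = \<sigma> n b"
proof -
  have "\<sigma> n ` carrier (chains B n) = carrier (chains C n)"
    using extension[of n] unfolding schreier_extension_def by blast
  with assms that show thesis by blast
qed

lemma representative:
  assumes "c \<in> carrier (chains C n)"
  obtains u where "u \<in> carrier (chains B n)" "\<sigma> n u = c"
    "\<And>b. b \<in> carrier (chains B n) \<Longrightarrow> \<sigma> n b = c \<Longrightarrow>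
      \<exists>!a. a \<in> carrier (chains G n) \<and> b = \<kappa> n a \<oplus>\<^bsub>chains B n\<^esub> u"
proof -
  have "\<forall>c\<in>carrier (chains C n). \<exists>u\<in>carrier (chains B n). \<sigma> n u = c \<and>
      (\<forall>b\<in>carrier (chains B n). \<sigma> n b = c \<longrightarrow>
        (\<exists>!a. a \<in> carrier (chains G n) \<and> b = \<kappa> n a \<oplus>\<^bsub>chains B n\<^esub> u))"
    using extension[of n] unfolding schreier_extension_def by (elim conjE)
  from bspec[OF this assms] obtain u where u: "u \<in> carrier (chains B n)" "\<sigma> n u = c"
    and rep: "\<forall>b\<in>carrier (chains B n). \<sigma> n b = c \<longrightarrow>
        (\<exists>!a. a \<in> carrier (chains G n) \<and> b = \<kappa> n a \<oplus>\<^bsub>chains B n\<^esub> u)"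
    by (elim bexE conjE)
  show thesis by (rule that[OF u]) (rule rep[rule_format])
qed

lemma fibre_transitive:
  assumes [simp]: "b \<in> carrier (chains B n)" "b' \<in> carrier (chains B n)" and eq: "\<sigma> n b = \<sigma> n b'"
  obtains g where "g \<in> carrier (chains G n)" "b = \<kappa> n g \<oplus>\<^bsub>chains B n\<^esub> b'"
proof -
  have "\<sigma> n b \<in> carrier (chains C n)" by simp
  then obtain u where u [simp]: "u \<in> carrier (chains B n)"
    and rep: "\<And>x. x \<in> carrier (chains B n) \<Longrightarrow> \<sigma> n x = \<sigma> n b \<Longrightarrow>
      \<exists>!a. a \<in> carrier (chains G n) \<and> x = \<kappa> n a \<oplus>\<^bsub>chains B n\<^esub> u"
    by (rule representative) blast
  obtain a where a [simp]: "a \<in> carrier (chains G n)" and b: "b = \<kappa> n a \<oplus>\<^bsub>chains B n\<^esub> u"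
    using rep[of b] by auto
  obtain a' where a' [simp]: "a' \<in> carrier (chains G n)" and b': "b' = \<kappa> n a' \<oplus>\<^bsub>chains B n\<^esub> u"
    using rep[of b'] eq by auto
  have "\<kappa> n (a \<ominus>\<^bsub>chains G n\<^esub> a') \<oplus>\<^bsub>chains B n\<^esub> b'
      = \<kappa> n ((a \<ominus>\<^bsub>chains G n\<^esub> a') \<oplus>\<^bsub>chains G n\<^esub> a') \<oplus>\<^bsub>chains B n\<^esub> u"
    by (simp add: b' B.ch.a_assoc)
  also have "(a \<ominus>\<^bsub>chains G n\<^esub> a') \<oplus>\<^bsub>chains G n\<^esub> a' = a"
    by (simp add: a_minus_def G.ch.a_assoc G.grp.l_neg)
  finally show thesis
    by (intro that[of "a \<ominus>\<^bsub>chains G n\<^esub> a'"]) (simp_all flip: b)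
qed

lemma fibre_free:
  assumes [simp]: "b \<in> carrier (chains B n)" "g \<in> carrier (chains G n)" "h \<in> carrier (chains G n)"
    and eq: "\<kappa> n g \<oplus>\<^bsub>chains B n\<^esub> b = \<kappa> n h \<oplus>\<^bsub>chains B n\<^esub> b"
  shows "g = h"
proof -
  have "\<sigma> n b \<in> carrier (chains C n)" by simp
  then obtain u where u [simp]: "u \<in> carrier (chains B n)"
    and rep: "\<And>x. x \<in> carrier (chains B n) \<Longrightarrow> \<sigma> n x = \<sigma> n b \<Longrightarrow>
      \<exists>!a. a \<in> carrier (chains G n) \<and> x = \<kappa> n a \<oplus>\<^bsub>chains B n\<^esub> u"
    by (rule representative) blast
  obtain a where a [simp]: "a \<in> carrier (chains G n)" and b: "b = \<kappa> n a \<oplus>\<^bsub>chains B n\<^esub> u"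
    using rep[of b] by auto
  let ?b' = "\<kappa> n g \<oplus>\<^bsub>chains B n\<^esub> b"
  have "?b' \<in> carrier (chains B n)" "\<sigma> n ?b' = \<sigma> n b" by simp_all
  from rep[OF this] have unique: "x = y"
    if "x \<in> carrier (chains G n)" "?b' = \<kappa> n x \<oplus>\<^bsub>chains B n\<^esub> u"
      "y \<in> carrier (chains G n)" "?b' = \<kappa> n y \<oplus>\<^bsub>chains B n\<^esub> u" for x y
    using that by blast
  have "?b' = \<kappa> n (g \<oplus>\<^bsub>chains G n\<^esub> a) \<oplus>\<^bsub>chains B n\<^esub> u"
    by (simp add: b B.ch.a_assoc)
  moreover have "?b' = \<kappa> n (h \<oplus>\<^bsub>chains G n\<^esub> a) \<oplus>\<^bsub>chains B n\<^esub> u"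
    unfolding eq by (simp add: b B.ch.a_assoc)
  ultimately have "g \<oplus>\<^bsub>chains G n\<^esub> a = h \<oplus>\<^bsub>chains G n\<^esub> a"
    by (intro unique) simp_all
  then show ?thesis by simp
qed

lemma \<kappa>_diff:
  "g \<in> carrier (chains G n) \<Longrightarrow>
    dpos B n (\<kappa> n g) = dneg B n (\<kappa> n g) \<oplus>\<^bsub>chains B (n - 1)\<^esub> \<kappa> (n - 1) (dpos G n g)"
  using \<kappa>.diff_map[of g n] by simp

text \<open>
  If \<open>g\<close> measures the difference of two elements whose formal difference is a cycle, then \<open>g\<close> is a
  cycle.  Applying \<open>\<partial>\<^sup>+\<close> and \<open>\<partial>\<^sup>-\<close> to the equation and adding the results crosswise shows that
  \<open>\<kappa> (d g)\<close> fixes an element of \<open>B\<close>, and the action is free.  The extra summand \<open>z\<close> is harmless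
  here, and it is needed because equations in the completion come with one.
\<close>

lemma cycle_of_cycle_pair:
  assumes st: "B.cycle_pair n s t" and [simp]: "g \<in> carrier (chains G n)" "z \<in> carrier (chains B n)"
    and eq: "\<kappa> n g \<oplus>\<^bsub>chains B n\<^esub> s \<oplus>\<^bsub>chains B n\<^esub> z = t \<oplus>\<^bsub>chains B n\<^esub> z"
  shows "g \<in> cycles G n"
proof -
  let ?B = "chains B (n - 1)" and ?p = "dpos B n" and ?m = "dneg B n"
  have [simp]: "s \<in> carrier (chains B n)" "t \<in> carrier (chains B n)"
    and pair: "?p s \<oplus>\<^bsub>?B\<^esub> ?m t = ?m s \<oplus>\<^bsub>?B\<^esub> ?p t"
    using st by (simp_all add: B.cycle_pair_def)
  let ?w = "?m (\<kappa> n g) \<oplus>\<^bsub>?B\<^esub> (?p s \<oplus>\<^bsub>?B\<^esub> ?m t) \<oplus>\<^bsub>?B\<^esub> ?p z \<oplus>\<^bsub>?B\<^esub> ?m z"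
  have p: "?m (\<kappa> n g) \<oplus>\<^bsub>?B\<^esub> \<kappa> (n - 1) (dpos G n g) \<oplus>\<^bsub>?B\<^esub> ?p s \<oplus>\<^bsub>?B\<^esub> ?p z = ?p t \<oplus>\<^bsub>?B\<^esub> ?p z"
    using arg_cong[OF eq, of ?p] by (simp add: \<kappa>_diff)
  have m: "?m (\<kappa> n g) \<oplus>\<^bsub>?B\<^esub> ?m s \<oplus>\<^bsub>?B\<^esub> ?m z = ?m t \<oplus>\<^bsub>?B\<^esub> ?m z"
    using arg_cong[OF eq, of ?m] by simp
  have "\<kappa> (n - 1) (dpos G n g) \<oplus>\<^bsub>?B\<^esub> ?w
      = (?m (\<kappa> n g) \<oplus>\<^bsub>?B\<^esub> \<kappa> (n - 1) (dpos G n g) \<oplus>\<^bsub>?B\<^esub> ?p s \<oplus>\<^bsub>?B\<^esub> ?p z)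
        \<oplus>\<^bsub>?B\<^esub> (?m t \<oplus>\<^bsub>?B\<^esub> ?m z)"
    by (simp add: B.ch.a_ac)
  also have "\<dots> = ?m (\<kappa> n g) \<oplus>\<^bsub>?B\<^esub> (?m s \<oplus>\<^bsub>?B\<^esub> ?p t) \<oplus>\<^bsub>?B\<^esub> ?p z \<oplus>\<^bsub>?B\<^esub> ?m z"
    unfolding p m[symmetric] by (simp add: B.ch.a_ac)
  also have "\<dots> = \<kappa> (n - 1) \<zero>\<^bsub>chains G (n - 1)\<^esub> \<oplus>\<^bsub>?B\<^esub> ?w"
    unfolding pair by simp
  finally have "dpos G n g = \<zero>\<^bsub>chains G (n - 1)\<^esub>"
    by (rule fibre_free[rotated 3]) simp_all
  then show ?thesis by (simp add: cycles_def)
qed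

lemma \<kappa>_cycle: "g \<in> cycles G n \<Longrightarrow> \<kappa> n g \<in> cycles B n"
  using \<kappa>_diff[of g n] by (auto simp: cycles_def)

text \<open>
  The morphism \<open>\<kappa>\<close> need satisfy neither alternative of \<open>strong_chain_morphism\<close>, but \<open>d\<^sup>- = 0\<close> on
  \<open>G\<close> turns the morphism law into \<open>\<partial>\<^sup>+ \<kappa> = \<partial>\<^sup>- \<kappa> + \<kappa> d\<close>, which can be substituted directly.
\<close>

lemma homology_\<kappa>_defined: "homology_map_defined G B \<kappa> n"
proof (rule \<kappa>.homology_map_definedI)
  show "\<kappa> n g \<in> cycles B n" if "g \<in> cycles G n" for g
    using that by (rule \<kappa>_cycle)
next
  fix x y u v
  assume x: "x \<in> cycles G n" "y \<in> cycles G n"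
    and uv [simp]: "u \<in> carrier (chains G (n + 1))" "v \<in> carrier (chains G (n + 1))"
    and "x \<oplus>\<^bsub>chains G n\<^esub> dpos G (n + 1) u \<oplus>\<^bsub>chains G n\<^esub> dneg G (n + 1) v =
      y \<oplus>\<^bsub>chains G n\<^esub> dpos G (n + 1) v \<oplus>\<^bsub>chains G n\<^esub> dneg G (n + 1) u"
  note [simp] = x[THEN G.cycle_closed]
  let ?B = "chains B n" and ?m = "dneg B (n + 1)" and ?k = "\<kappa> (n + 1)"
  have "x \<oplus>\<^bsub>chains G n\<^esub> dpos G (n + 1) u = y \<oplus>\<^bsub>chains G n\<^esub> dpos G (n + 1) v"
    using \<open>x \<oplus>\<^bsub>_\<^esub> _ \<oplus>\<^bsub>_\<^esub> _ = _\<close> by simp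
  from arg_cong[OF this, of "\<kappa> n"]
  have eq: "\<kappa> n x \<oplus>\<^bsub>?B\<^esub> \<kappa> n (dpos G (n + 1) u) = \<kappa> n y \<oplus>\<^bsub>?B\<^esub> \<kappa> n (dpos G (n + 1) v)"
    by simp
  have d: "dpos B (n + 1) (?k w) = ?m (?k w) \<oplus>\<^bsub>?B\<^esub> \<kappa> n (dpos G (n + 1) w)"
    if "w \<in> carrier (chains G (n + 1))" for w
    using \<kappa>_diff[OF that] by simp
  have "\<kappa> n x \<oplus>\<^bsub>?B\<^esub> dpos B (n + 1) (?k u) \<oplus>\<^bsub>?B\<^esub> ?m (?k v)
      = (\<kappa> n x \<oplus>\<^bsub>?B\<^esub> \<kappa> n (dpos G (n + 1) u)) \<oplus>\<^bsub>?B\<^esub> (?m (?k u) \<oplus>\<^bsub>?B\<^esub> ?m (?k v))"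
    unfolding d[OF uv(1)] by (simp add: B.ch.a_ac)
  also have "\<dots> = \<kappa> n y \<oplus>\<^bsub>?B\<^esub> dpos B (n + 1) (?k v) \<oplus>\<^bsub>?B\<^esub> ?m (?k u)"
    unfolding eq d[OF uv(2)] by (simp add: B.ch.a_ac)
  finally show "\<kappa> n x \<oplus>\<^bsub>?B\<^esub> dpos B (n + 1) (?k u) \<oplus>\<^bsub>?B\<^esub> ?m (?k v)
      = \<kappa> n y \<oplus>\<^bsub>?B\<^esub> dpos B (n + 1) (?k v) \<oplus>\<^bsub>?B\<^esub> ?m (?k u)" .
qed

lemma \<sigma>_cycle: "b \<in> cycles B n \<Longrightarrow> \<sigma> n b \<in> cycles C n"
  using \<sigma>.homology_map_defined[of n] by (auto simp: homology_map_defined_def)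

lemmas homology_\<kappa>_hclass = \<kappa>.homology_map_hclass[OF homology_\<kappa>_defined]
  and homology_\<sigma>_hclass = \<sigma>.homology_map_hclass[OF \<sigma>.homology_map_defined]
  and homology_\<kappa>_hom = \<kappa>.homology_map_hom[OF homology_\<kappa>_defined]
  and homology_\<sigma>_hom = \<sigma>.homology_map_hom[OF \<sigma>.homology_map_defined]

text \<open>
  This carries exactness at \<open>H\<^sub>n(B)\<close> (take \<open>b' = 0\<close>) as well as normality of \<open>H\<^sub>n(\<sigma>)\<close>.  A homology
  between \<open>\<sigma> b\<close> and \<open>\<sigma> b'\<close> lifts to two elements of one fibre of \<open>\<sigma>\<close>, and the element \<open>g\<close> that
  moves one to the other is a cycle.
\<close>

lemma homologous_images:
  assumes b: "b \<in> cycles B n" "b' \<in> cycles B n"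
    and eq: "hclass C n (\<sigma> n b) = hclass C n (\<sigma> n b')"
  obtains g where "g \<in> cycles G n" "hclass B n b = hclass B n (\<kappa> n g \<oplus>\<^bsub>chains B n\<^esub> b')"
proof -
  note bc [simp] = b[THEN B.cycle_closed]
  let ?B = "chains B n" and ?p = "dpos B (n + 1)" and ?m = "dneg B (n + 1)"
  have "(\<sigma> n b, \<sigma> n b') \<in> homology_rel C n"
    using eq b by (simp add: C.hclass_eq_iff \<sigma>_cycle)
  then obtain s t where st: "s \<in> carrier (chains C (n + 1))" "t \<in> carrier (chains C (n + 1))"
    and rel: "\<sigma> n b \<oplus>\<^bsub>chains C n\<^esub> dpos C (n + 1) s \<oplus>\<^bsub>chains C n\<^esub> dneg C (n + 1) t =
      \<sigma> n b' \<oplus>\<^bsub>chains C n\<^esub> dpos C (n + 1) t \<oplus>\<^bsub>chains C n\<^esub> dneg C (n + 1) s"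
    by (rule C.homology_relE)
  obtain u where u [simp]: "u \<in> carrier (chains B (n + 1))" and s: "s = \<sigma> (n + 1) u"
    using st(1) by (rule \<sigma>_surj)
  obtain v where v [simp]: "v \<in> carrier (chains B (n + 1))" and t: "t = \<sigma> (n + 1) v"
    using st(2) by (rule \<sigma>_surj)
  have "\<sigma> n (b \<oplus>\<^bsub>?B\<^esub> ?p u \<oplus>\<^bsub>?B\<^esub> ?m v) = \<sigma> n (b' \<oplus>\<^bsub>?B\<^esub> ?p v \<oplus>\<^bsub>?B\<^esub> ?m u)"
    using rel unfolding s t by (simp add: \<sigma>.map_boundary_iff)
  then obtain g where g [simp]: "g \<in> carrier (chains G n)"
    and bg: "b \<oplus>\<^bsub>?B\<^esub> ?p u \<oplus>\<^bsub>?B\<^esub> ?m v = \<kappa> n g \<oplus>\<^bsub>?B\<^esub> (b' \<oplus>\<^bsub>?B\<^esub> ?p v \<oplus>\<^bsub>?B\<^esub> ?m u)"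
    by (rule fibre_transitive[rotated 2]) simp_all
  have "B.cycle_pair n (?p v) (?m v)" "B.cycle_pair n (?m u) (?p u)"
    using B.cycle_pair_diff[OF v] B.cycle_pair_sym[OF B.cycle_pair_diff[OF u]] by simp_all
  \<comment> \<open>the zeros pair the cycles \<open>b\<close> and \<open>b'\<close> with \<open>0\<close>, so that all four summands are cycle pairs\<close>
  then have "B.cycle_pair n (b' \<oplus>\<^bsub>?B\<^esub> \<zero>\<^bsub>?B\<^esub> \<oplus>\<^bsub>?B\<^esub> ?p v \<oplus>\<^bsub>?B\<^esub> ?m u)
      (\<zero>\<^bsub>?B\<^esub> \<oplus>\<^bsub>?B\<^esub> b \<oplus>\<^bsub>?B\<^esub> ?m v \<oplus>\<^bsub>?B\<^esub> ?p u)"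
    using b by (intro B.cycle_pair_add B.cycle_pair_cycle
      B.cycle_pair_sym[OF B.cycle_pair_cycle])
  then have gc: "g \<in> cycles G n"
    by (rule cycle_of_cycle_pair[of _ _ _ _ "\<zero>\<^bsub>?B\<^esub>"])
      (simp_all add: bg[symmetric], simp add: B.ch.a_ac)
  moreover have "(b, \<kappa> n g \<oplus>\<^bsub>?B\<^esub> b') \<in> homology_rel B n"
    by (rule B.homology_relI[OF b(1) B.add_cycle[OF \<kappa>_cycle[OF gc] b(2)] u v])
      (simp add: bg B.ch.a_assoc)
  ultimately show thesis
    by (intro that[OF gc])
      (simp add: B.hclass_eq_iff[OF b(1) B.add_cycle[OF \<kappa>_cycle[OF gc] b(2)]])
qed

lemma homology_\<sigma>_\<kappa>:
  assumes "g \<in> cycles G n"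
  shows "homology_map C \<sigma> n (hclass B n (\<kappa> n g)) = \<zero>\<^bsub>homology C n\<^esub>"
  using assms by (simp add: homology_\<sigma>_hclass \<kappa>_cycle G.cycle_closed C.homology_zero)

lemma exact_at_B:
  "exact_at R (homology G n) (homology_map B \<kappa> n) (homology B n) (homology_map C \<sigma> n) (homology C n)"
proof -
  have "homology_map B \<kappa> n ` carrier (homology G n)
      = a_kernel (homology B n) (homology C n) (homology_map C \<sigma> n)"
  proof (intro subset_antisym subsetI)
    fix W assume "W \<in> homology_map B \<kappa> n ` carrier (homology G n)"
    then show "W \<in> a_kernel (homology B n) (homology C n) (homology_map C \<sigma> n)"
      by (auto simp: a_kernel_def' homology_\<kappa>_hclass homology_\<sigma>_\<kappa> B.hclass_closed \<kappa>_cycle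
          elim!: G.homologyE)
  next
    fix W assume "W \<in> a_kernel (homology B n) (homology C n) (homology_map C \<sigma> n)"
    then have "W \<in> carrier (homology B n)" and ker: "homology_map C \<sigma> n W = \<zero>\<^bsub>homology C n\<^esub>"
      by (auto simp: a_kernel_def')
    then obtain b where b: "b \<in> cycles B n" "W = hclass B n b" by (auto elim: B.homologyE)
    then have "hclass C n (\<sigma> n b) = hclass C n (\<sigma> n \<zero>\<^bsub>chains B n\<^esub>)"
      using ker by (simp add: homology_\<sigma>_hclass C.homology_zero)
    then obtain g where "g \<in> cycles G n" "hclass B n b = hclass B n (\<kappa> n g)"
      by (rule homologous_images[OF b(1) B.zero_cycle]) (simp add: \<kappa>_cycle B.cycle_closed)
    then show "W \<in> homology_map B \<kappa> n ` carrier (homology G n)"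
      using b by (intro image_eqI[of _ _ "hclass G n g"])
        (simp_all add: homology_\<kappa>_hclass G.hclass_closed)
  qed
  then show ?thesis by (simp add: exact_at_def homology_\<kappa>_hom homology_\<sigma>_hom)
qed

lemma normal_homology_\<sigma>: "normal_hom R (homology B n) (homology C n) (homology_map C \<sigma> n)"
proof -
  interpret HB: semimodule R "homology B n" by (rule B.semimodule_homology)
  have "\<exists>k\<in>a_kernel (homology B n) (homology C n) (homology_map C \<sigma> n).
      \<exists>k'\<in>a_kernel (homology B n) (homology C n) (homology_map C \<sigma> n).
        k \<oplus>\<^bsub>homology B n\<^esub> U = k' \<oplus>\<^bsub>homology B n\<^esub> V"
    if UV: "U \<in> carrier (homology B n)" "V \<in> carrier (homology B n)"
      and eq: "homology_map C \<sigma> n U = homology_map C \<sigma> n V" for U V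
  proof -
    from UV obtain b b' where b: "b \<in> cycles B n" "U = hclass B n b"
      and b': "b' \<in> cycles B n" "V = hclass B n b'"
      by (metis B.homologyE)
    with eq have "hclass C n (\<sigma> n b) = hclass C n (\<sigma> n b')" by (simp add: homology_\<sigma>_hclass)
    then obtain g where g: "g \<in> cycles G n"
        "hclass B n b = hclass B n (\<kappa> n g \<oplus>\<^bsub>chains B n\<^esub> b')"
      by (rule homologous_images[OF b(1) b'(1)])
    have "\<zero>\<^bsub>homology B n\<^esub> \<oplus>\<^bsub>homology B n\<^esub> U = hclass B n (\<kappa> n g) \<oplus>\<^bsub>homology B n\<^esub> V"
      using b' g UV(1) by (simp add: b(2) B.hclass_add \<kappa>_cycle)
    moreover have "hclass B n (\<kappa> n g) \<in> a_kernel (homology B n) (homology C n) (homology_map C \<sigma> n)"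
      using g(1) by (simp add: a_kernel_def' homology_\<sigma>_\<kappa> B.hclass_closed \<kappa>_cycle)
    moreover have "\<zero>\<^bsub>homology B n\<^esub> \<in> a_kernel (homology B n) (homology C n) (homology_map C \<sigma> n)"
      using semimodule_hom.hom_zero[OF homology_\<sigma>_hom] by (simp add: a_kernel_def')
    ultimately show ?thesis by blast
  qed
  then show ?thesis by (simp add: normal_hom_def homology_\<sigma>_hom)
qed

section \<open>The connecting homomorphism\<close>

text \<open>
  The snake construction in terms of representatives: the equation says that the differential of
  \<open>[u, v]\<close> in \<open>K(B)\<close> is the image of \<open>[g, 0]\<close>, the element \<open>z\<close> being the witness of this equality
  in the completion.  Hence the connecting homomorphism of \<open>K(E)\<close> sends the class of
  \<open>[\<sigma> u, \<sigma> v]\<close> to the class of \<open>g\<close>.  The case \<open>v = 0\<close>, \<open>z = 0\<close> describes classes coming from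
  \<open>H\<^sub>n(C)\<close>; the case \<open>z = 0\<close> says that \<open>\<kappa> g\<close> is null-homologous in \<open>B\<close>.
\<close>

definition lifts :: "int \<Rightarrow> 'b \<Rightarrow> 'b \<Rightarrow> 'b \<Rightarrow> 'g \<Rightarrow> bool" where
  "lifts n u v z g \<longleftrightarrow>
    u \<in> carrier (chains B n) \<and> v \<in> carrier (chains B n) \<and>
    z \<in> carrier (chains B (n - 1)) \<and> g \<in> carrier (chains G (n - 1)) \<and>
    dpos B n u \<oplus>\<^bsub>chains B (n - 1)\<^esub> dneg B n v \<oplus>\<^bsub>chains B (n - 1)\<^esub> z =
    \<kappa> (n - 1) g \<oplus>\<^bsub>chains B (n - 1)\<^esub> (dpos B n v \<oplus>\<^bsub>chains B (n - 1)\<^esub> dneg B n u)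
      \<oplus>\<^bsub>chains B (n - 1)\<^esub> z"

lemma lifts_cycle:
  assumes "lifts n u v z g"
  shows "g \<in> cycles G (n - 1)"
proof -
  have [simp]: "u \<in> carrier (chains B n)" "v \<in> carrier (chains B n)"
    using assms by (simp_all add: lifts_def)
  have "B.cycle_pair (n - 1) (dpos B n v \<oplus>\<^bsub>chains B (n - 1)\<^esub> dneg B n u)
      (dneg B n v \<oplus>\<^bsub>chains B (n - 1)\<^esub> dpos B n u)"
    by (intro B.cycle_pair_add B.cycle_pair_diff
        B.cycle_pair_sym[OF B.cycle_pair_diff]) simp_all
  then show ?thesis
    by (rule cycle_of_cycle_pair[of _ _ _ _ z]) (use assms in \<open>simp_all add: lifts_def B.ch.a_comm\<close>)
qed

text \<open>
  Both properties of the action pass to the completion, where equations hold up to a summand: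
  freeness is insensitive to a summand in \<open>B\<close>, and for transitivity the summand in \<open>C\<close> is lifted
  to \<open>B\<close>.
\<close>

lemma inj_on_completed_\<kappa>:
  "inj_on (completion_morphism B \<kappa> n) (carrier (completion (chains G n)))"
proof (rule inj_onI)
  fix U V assume "U \<in> carrier (completion (chains G n))" "V \<in> carrier (completion (chains G n))"
    and UV: "completion_morphism B \<kappa> n U = completion_morphism B \<kappa> n V"
  then obtain x y s t where [simp]: "x \<in> carrier (chains G n)" "y \<in> carrier (chains G n)"
      "s \<in> carrier (chains G n)" "t \<in> carrier (chains G n)"
    and U: "U = completion_class (chains G n) (x, y)" and V: "V = completion_class (chains G n) (s, t)"
    by (auto elim!: G.K.completionE)
  from UV obtain w where [simp]: "w \<in> carrier (chains B n)"
    and "\<kappa> n (x \<oplus>\<^bsub>chains G n\<^esub> t) \<oplus>\<^bsub>chains B n\<^esub> w =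
      \<kappa> n (y \<oplus>\<^bsub>chains G n\<^esub> s) \<oplus>\<^bsub>chains B n\<^esub> w"
    unfolding U V by (auto simp: B.K.cclass_eq_iff)
  then have "x \<oplus>\<^bsub>chains G n\<^esub> t = y \<oplus>\<^bsub>chains G n\<^esub> s"
    by (intro fibre_free[of w n]) simp_all
  then show "U = V" unfolding U V by (intro G.K.cclass_eqI) simp_all
qed

lemma completed_\<sigma>_preimage:
  assumes "V \<in> carrier (completion (chains C n))"
  obtains u v where "u \<in> carrier (chains B n)" "v \<in> carrier (chains B n)"
    "V = completion_class (chains C n) (\<sigma> n u, \<sigma> n v)"
  using assms by (metis C.K.completionE \<sigma>_surj)

lemma completed_fibre_transitive:
  assumes "U \<in> carrier (completion (chains B n))" "V \<in> carrier (completion (chains B n))"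
    and UV: "completion_morphism C \<sigma> n U = completion_morphism C \<sigma> n V"
  shows "\<exists>e\<in>carrier (completion (chains G n)).
    U = completion_morphism B \<kappa> n e \<oplus>\<^bsub>completion (chains B n)\<^esub> V"
proof -
  let ?B = "chains B n"
  from assms(1,2) obtain x y s t where [simp]: "x \<in> carrier ?B" "y \<in> carrier ?B"
      "s \<in> carrier ?B" "t \<in> carrier ?B"
    and U: "U = completion_class ?B (x, y)" and V: "V = completion_class ?B (s, t)"
    by (auto elim!: B.K.completionE)
  from UV obtain c where c: "c \<in> carrier (chains C n)"
    and xyst: "\<sigma> n x \<oplus>\<^bsub>chains C n\<^esub> \<sigma> n t \<oplus>\<^bsub>chains C n\<^esub> c =
      \<sigma> n y \<oplus>\<^bsub>chains C n\<^esub> \<sigma> n s \<oplus>\<^bsub>chains C n\<^esub> c"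
    unfolding U V by (auto simp: C.K.cclass_eq_iff)
  obtain w where w [simp]: "w \<in> carrier ?B" and "c = \<sigma> n w"
    using c by (rule \<sigma>_surj)
  then have "\<sigma> n (x \<oplus>\<^bsub>?B\<^esub> t \<oplus>\<^bsub>?B\<^esub> w) = \<sigma> n (y \<oplus>\<^bsub>?B\<^esub> s \<oplus>\<^bsub>?B\<^esub> w)"
    using xyst by simp
  then obtain e where e [simp]: "e \<in> carrier (chains G n)"
    and "x \<oplus>\<^bsub>?B\<^esub> t \<oplus>\<^bsub>?B\<^esub> w = \<kappa> n e \<oplus>\<^bsub>?B\<^esub> (y \<oplus>\<^bsub>?B\<^esub> s \<oplus>\<^bsub>?B\<^esub> w)"
    by (rule fibre_transitive[rotated 2]) simp_all
  then have "x \<oplus>\<^bsub>?B\<^esub> t \<oplus>\<^bsub>?B\<^esub> w = y \<oplus>\<^bsub>?B\<^esub> (\<kappa> n e \<oplus>\<^bsub>?B\<^esub> s) \<oplus>\<^bsub>?B\<^esub> w"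
    by (simp add: B.ch.a_ac)
  then have "U = completion_class ?B (\<kappa> n e \<oplus>\<^bsub>?B\<^esub> s, t)"
    unfolding U using w by (auto simp: B.K.cclass_eq_iff)
  then show ?thesis
    by (intro bexI[of _ "completion_class (chains G n) (e, \<zero>\<^bsub>chains G n\<^esub>)"])
      (simp_all add: V)
qed

lemma
  assumes lift: "lifts n u v z g"
  shows lifts_completed_cycle:
      "completion_class (chains C n) (\<sigma> n u, \<sigma> n v) \<in> cycles (completion_complex C) n"
    and completed_connecting_lifts:
      "completed_connecting G B C \<kappa> \<sigma> n
        (hclass (completion_complex C) n (completion_class (chains C n) (\<sigma> n u, \<sigma> n v)))
        = hclass G (n - 1) g"
proof -
  interpret KG: module_complex R "completion_complex G" by (rule G.module_complex_completion)
  interpret KB: module_complex R "completion_complex B" by (rule B.module_complex_completion)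
  interpret KC: module_complex R "completion_complex C" by (rule C.module_complex_completion)
  interpret K\<kappa>: semimodule_complex_maps R "completion_complex G" "completion_complex B"
    "completion_morphism B \<kappa>" by (rule \<kappa>.completion_morphism_maps)
  interpret K\<sigma>: semimodule_complex_maps R "completion_complex B" "completion_complex C"
    "completion_morphism C \<sigma>" by (rule \<sigma>.completion_morphism_maps)
  have [simp]: "u \<in> carrier (chains B n)" "v \<in> carrier (chains B n)"
      "z \<in> carrier (chains B (n - 1))" "g \<in> carrier (chains G (n - 1))"
    and eq: "dpos B n u \<oplus>\<^bsub>chains B (n - 1)\<^esub> dneg B n v \<oplus>\<^bsub>chains B (n - 1)\<^esub> z =
      \<kappa> (n - 1) g \<oplus>\<^bsub>chains B (n - 1)\<^esub> (dpos B n v \<oplus>\<^bsub>chains B (n - 1)\<^esub> dneg B n u)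
        \<oplus>\<^bsub>chains B (n - 1)\<^esub> z"
    using lift by (simp_all add: lifts_def)
  let ?b = "completion_class (chains B n) (u, v)"
  let ?a = "completion_class (chains G (n - 1)) (g, \<zero>\<^bsub>chains G (n - 1)\<^esub>)"
  have a: "?a \<in> cycles (completion_complex G) (n - 1)"
    using lifts_cycle[OF lift] by (rule G.unit_cycle)
  have \<kappa>a: "completion_morphism B \<kappa> (n - 1) ?a = dpos (completion_complex B) n ?b"
    using eq by (auto simp: B.K.cclass_eq_iff intro!: bexI[of _ z])
  have "dpos (completion_complex C) n (completion_morphism C \<sigma> n ?b) =
      completion_morphism C \<sigma> (n - 1) (completion_morphism B \<kappa> (n - 1) ?a)"
    unfolding \<kappa>a by (rule \<sigma>.completion_morphism_diff) simp
  also have "\<dots> = \<zero>\<^bsub>completion (chains C (n - 1))\<^esub>"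
    by (simp add: C.K.completion_zero)
  finally have cyc: "completion_morphism C \<sigma> n ?b \<in> cycles (completion_complex C) n"
    by (simp add: cycles_def)
  then show "completion_class (chains C n) (\<sigma> n u, \<sigma> n v) \<in> cycles (completion_complex C) n"
    by simp
  have "connecting_hom (completion_complex G) (completion_complex B)
      (completion_morphism B \<kappa>) (completion_morphism C \<sigma>) n
      (hclass (completion_complex C) n (completion_morphism C \<sigma> n ?b))
    = hclass (completion_complex G) (n - 1) ?a"
  proof (rule connecting_hom_hclass[OF KG.module_complex_axioms KB.module_complex_axioms
        KC.module_complex_axioms K\<kappa>.semimodule_complex_maps_axioms K\<sigma>.semimodule_complex_maps_axioms
        _ _ _ _ _ _ cyc a \<kappa>a])
    show "completion_morphism C \<sigma> n ` carrier (chains (completion_complex B) n)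
        = carrier (chains (completion_complex C) n)" for n
    proof
      show "carrier (chains (completion_complex C) n)
          \<subseteq> completion_morphism C \<sigma> n ` carrier (chains (completion_complex B) n)"
      proof
        fix V assume "V \<in> carrier (chains (completion_complex C) n)"
        then obtain s t where "s \<in> carrier (chains B n)" "t \<in> carrier (chains B n)"
          "V = completion_class (chains C n) (\<sigma> n s, \<sigma> n t)"
          unfolding completion_complex_simps by (rule completed_\<sigma>_preimage)
        then show "V \<in> completion_morphism C \<sigma> n ` carrier (chains (completion_complex B) n)"
          by (intro image_eqI[of _ _ "completion_class (chains B n) (s, t)"]) simp_all
      qed
    qed (use K\<sigma>.map_closed in blast)
  qed (simp_all add: \<kappa>.completion_morphism_diff \<sigma>.completion_morphism_diff
      inj_on_completed_\<kappa> completed_fibre_transitive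
      del: \<sigma>.completion_morphism_cclass)
  moreover have "hclass (completion_complex G) (n - 1) ?a =
      homology_map (completion_complex G) (complex_unit G) (n - 1) (hclass G (n - 1) g)"
    using lifts_cycle[OF lift] by (simp add: G.homology_unit_hclass)
  ultimately show "completed_connecting G B C \<kappa> \<sigma> n
      (hclass (completion_complex C) n (completion_class (chains C n) (\<sigma> n u, \<sigma> n v)))
      = hclass G (n - 1) g"
    using inv_into_f_f[OF G.inj_on_homology_unit G.hclass_closed[OF lifts_cycle[OF lift]]]
    by (simp add: completed_connecting_def)
qed

text \<open>
  A cycle \<open>[\<sigma> u, \<sigma> v]\<close> of \<open>K(C)\<close> has boundary zero only up to a summand \<open>c\<close> of \<open>C\<close>; a preimage of
  \<open>c\<close> provides \<open>z\<close>.
\<close>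

lemma liftsE:
  assumes "U \<in> carrier (homology (completion_complex C) n)"
  obtains u v z g where "lifts n u v z g"
    "U = hclass (completion_complex C) n (completion_class (chains C n) (\<sigma> n u, \<sigma> n v))"
proof -
  interpret KC: module_complex R "completion_complex C" by (rule C.module_complex_completion)
  from assms obtain V where V: "V \<in> cycles (completion_complex C) n"
    and U: "U = hclass (completion_complex C) n V" by (rule KC.homologyE)
  from V have "V \<in> carrier (completion (chains C n))" by (auto simp: cycles_def)
  then obtain u v where [simp]: "u \<in> carrier (chains B n)" "v \<in> carrier (chains B n)"
    and Vuv: "V = completion_class (chains C n) (\<sigma> n u, \<sigma> n v)" by (rule completed_\<sigma>_preimage)
  let ?B = "chains B (n - 1)" and ?C = "chains C (n - 1)"
  let ?s = "dpos B n u \<oplus>\<^bsub>?B\<^esub> dneg B n v" and ?t = "dpos B n v \<oplus>\<^bsub>?B\<^esub> dneg B n u"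
  have "completion_class ?C (\<sigma> (n - 1) ?s, \<sigma> (n - 1) ?t)
      = dpos (completion_complex C) n V"
    using \<sigma>.completion_morphism_diff[of "completion_class (chains B n) (u, v)" n]
    by (simp add: Vuv del: C.completion_diff_cclass)
  also have "\<dots> = completion_class ?C (\<zero>\<^bsub>?C\<^esub>, \<zero>\<^bsub>?C\<^esub>)"
    using V by (simp add: cycles_def C.K.completion_zero)
  finally obtain c where c: "c \<in> carrier ?C"
    and st: "\<sigma> (n - 1) ?s \<oplus>\<^bsub>?C\<^esub> c = \<sigma> (n - 1) ?t \<oplus>\<^bsub>?C\<^esub> c"
    by (subst (asm) C.K.cclass_eq_iff) auto
  obtain z where z [simp]: "z \<in> carrier ?B" and "c = \<sigma> (n - 1) z" using c by (rule \<sigma>_surj)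
  with st have "\<sigma> (n - 1) (?s \<oplus>\<^bsub>?B\<^esub> z) = \<sigma> (n - 1) (?t \<oplus>\<^bsub>?B\<^esub> z)" by simp
  then obtain g where "g \<in> carrier (chains G (n - 1))"
    "?s \<oplus>\<^bsub>?B\<^esub> z = \<kappa> (n - 1) g \<oplus>\<^bsub>?B\<^esub> (?t \<oplus>\<^bsub>?B\<^esub> z)"
    by (rule fibre_transitive[rotated 2]) simp_all
  then have "lifts n u v z g" by (simp add: lifts_def B.ch.a_assoc)
  then show thesis by (rule that) (simp add: U Vuv)
qed

lemma completed_connecting_image:
  "completed_connecting G B C \<kappa> \<sigma> n ` carrier (homology (completion_complex C) n)
    = {hclass G (n - 1) g | g. \<exists>u v z. lifts n u v z g}"
proof -
  interpret KC: module_complex R "completion_complex C" by (rule C.module_complex_completion)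
  show ?thesis
  proof (intro subset_antisym subsetI)
    fix W assume "W \<in> completed_connecting G B C \<kappa> \<sigma> n ` carrier (homology (completion_complex C) n)"
    then obtain U where "U \<in> carrier (homology (completion_complex C) n)"
      and W: "W = completed_connecting G B C \<kappa> \<sigma> n U" by blast
    then obtain u v z g where "lifts n u v z g"
      "U = hclass (completion_complex C) n (completion_class (chains C n) (\<sigma> n u, \<sigma> n v))"
      by (elim liftsE)
    then show "W \<in> {hclass G (n - 1) g | g. \<exists>u v z. lifts n u v z g}"
      unfolding W by (auto simp: completed_connecting_lifts)
  next
    fix W assume "W \<in> {hclass G (n - 1) g | g. \<exists>u v z. lifts n u v z g}"
    then obtain g u v z where l: "lifts n u v z g" and W: "W = hclass G (n - 1) g" by blast
    show "W \<in> completed_connecting G B C \<kappa> \<sigma> n ` carrier (homology (completion_complex C) n)"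
      unfolding W
      by (rule image_eqI, rule completed_connecting_lifts[OF l, symmetric])
        (rule KC.hclass_closed[OF lifts_completed_cycle[OF l]])
  qed
qed

lemma boundary_hclass:
  assumes b: "b \<in> carrier (chains B n)" "\<sigma> n b \<in> cycles C n" and g: "g \<in> carrier (chains G (n - 1))"
    and eq: "dpos B n b = \<kappa> (n - 1) g \<oplus>\<^bsub>chains B (n - 1)\<^esub> dneg B n b"
  shows "boundary G B C \<kappa> \<sigma> n (hclass C n (\<sigma> n b)) = hclass G (n - 1) g"
proof -
  have "lifts n b \<zero>\<^bsub>chains B n\<^esub> \<zero>\<^bsub>chains B (n - 1)\<^esub> g"
    using b g by (simp add: lifts_def eq)
  from completed_connecting_lifts[OF this] show ?thesis
    using b by (simp add: boundary_def C.homology_unit_hclass)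
qed

text \<open>
  For an honest cycle of \<open>C\<close> both \<open>v\<close> and \<open>z\<close> can be taken to be zero; this is where the hypothesis
  on \<open>\<sigma>\<close> enters the construction of the connecting homomorphism.
\<close>

lemma cycle_liftE:
  assumes "c \<in> cycles C n"
  obtains b g where "b \<in> carrier (chains B n)" "c = \<sigma> n b" "g \<in> cycles G (n - 1)"
    "dpos B n b = \<kappa> (n - 1) g \<oplus>\<^bsub>chains B (n - 1)\<^esub> dneg B n b"
proof -
  from assms have "c \<in> carrier (chains C n)" by (rule C.cycle_closed)
  then obtain b where b [simp]: "b \<in> carrier (chains B n)" and c: "c = \<sigma> n b" by (rule \<sigma>_surj)
  have "\<sigma> (n - 1) (dpos B n b) = \<sigma> (n - 1) (dneg B n b)"
    using assms \<sigma>.map_cycle_iff[OF b] by (simp add: c cycles_def)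
  then obtain g where g [simp]: "g \<in> carrier (chains G (n - 1))"
    and eq: "dpos B n b = \<kappa> (n - 1) g \<oplus>\<^bsub>chains B (n - 1)\<^esub> dneg B n b"
    by (rule fibre_transitive[rotated 2]) simp_all
  have "g \<in> cycles G (n - 1)"
    by (rule cycle_of_cycle_pair[OF B.cycle_pair_sym[OF B.cycle_pair_diff[OF b]], of _ "\<zero>\<^bsub>chains B (n - 1)\<^esub>"])
      (simp_all flip: eq)
  with b c show thesis using eq by (rule that)
qed

lemma boundary_hom: "semimodule_hom R (homology C n) (homology G (n - 1)) (boundary G B C \<kappa> \<sigma> n)"
proof (rule semimodule_homI[OF C.semimodule_homology G.semimodule_homology])
  let ?D = "boundary G B C \<kappa> \<sigma> n" and ?B = "chains B (n - 1)"
  fix U assume "U \<in> carrier (homology C n)"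
  then obtain c where c: "c \<in> cycles C n" and Uc: "U = hclass C n c" by (rule C.homologyE)
  from c obtain b g where b: "b \<in> carrier (chains B n)" "c = \<sigma> n b" and g: "g \<in> cycles G (n - 1)"
    and eq: "dpos B n b = \<kappa> (n - 1) g \<oplus>\<^bsub>?B\<^esub> dneg B n b" by (rule cycle_liftE)
  note [simp] = b(1) g[THEN G.cycle_closed]
  have DU: "?D U = hclass G (n - 1) g"
    using c eq unfolding Uc b(2) by (intro boundary_hclass) simp_all
  show "?D U \<in> carrier (homology G (n - 1))"
    using g by (simp add: DU G.hclass_closed)
  show "?D (r \<odot>\<^bsub>homology C n\<^esub> U) = r \<odot>\<^bsub>homology G (n - 1)\<^esub> ?D U" if r: "r \<in> carrier R" for r
  proof -
    have "?D (hclass C n (\<sigma> n (r \<odot>\<^bsub>chains B n\<^esub> b))) =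
        hclass G (n - 1) (r \<odot>\<^bsub>chains G (n - 1)\<^esub> g)"
      using r C.smult_cycle[OF r c] eq
      by (intro boundary_hclass) (simp_all add: b(2) B.ch.smult_r_distr)
    then show ?thesis using r c g unfolding DU by (simp add: Uc b(2) C.hclass_smult G.hclass_smult)
  qed
  fix V assume "V \<in> carrier (homology C n)"
  then obtain c' where c': "c' \<in> cycles C n" and Vc: "V = hclass C n c'" by (rule C.homologyE)
  from c' obtain b' g' where b': "b' \<in> carrier (chains B n)" "c' = \<sigma> n b'" and g': "g' \<in> cycles G (n - 1)"
    and eq': "dpos B n b' = \<kappa> (n - 1) g' \<oplus>\<^bsub>?B\<^esub> dneg B n b'" by (rule cycle_liftE)
  note [simp] = b'(1) g'[THEN G.cycle_closed]
  have DV: "?D V = hclass G (n - 1) g'"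
    using c' eq' unfolding Vc b'(2) by (intro boundary_hclass) simp_all
  have "?D (hclass C n (\<sigma> n (b \<oplus>\<^bsub>chains B n\<^esub> b'))) =
      hclass G (n - 1) (g \<oplus>\<^bsub>chains G (n - 1)\<^esub> g')"
  proof (rule boundary_hclass)
    show "\<sigma> n (b \<oplus>\<^bsub>chains B n\<^esub> b') \<in> cycles C n"
      using C.add_cycle[OF c c'] by (simp add: b(2) b'(2))
    show "dpos B n (b \<oplus>\<^bsub>chains B n\<^esub> b') = \<kappa> (n - 1) (g \<oplus>\<^bsub>chains G (n - 1)\<^esub> g')
        \<oplus>\<^bsub>?B\<^esub> dneg B n (b \<oplus>\<^bsub>chains B n\<^esub> b')"
      using eq eq' by (simp add: B.ch.a_ac)
  qed simp_all
  then show "?D (U \<oplus>\<^bsub>homology C n\<^esub> V) = ?D U \<oplus>\<^bsub>homology G (n - 1)\<^esub> ?D V"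
    using c c' g g' unfolding DU DV by (simp add: Uc b(2) Vc b'(2) C.hclass_add G.hclass_add)
qed

text \<open>
  If \<open>g + d w = 0\<close> for the class \<open>g\<close> attached to a lift \<open>b\<close>, then translating \<open>b\<close> by \<open>\<kappa> w\<close> turns
  it into a cycle without changing its image in \<open>C\<close>.
\<close>

lemma exact_at_C:
  "exact_at R (homology B n) (homology_map C \<sigma> n) (homology C n)
    (boundary G B C \<kappa> \<sigma> n) (homology G (n - 1))"
proof -
  let ?D = "boundary G B C \<kappa> \<sigma> n" and ?B = "chains B (n - 1)"
  have "homology_map C \<sigma> n ` carrier (homology B n) = a_kernel (homology C n) (homology G (n - 1)) ?D"
  proof (intro subset_antisym subsetI)
    fix W assume "W \<in> homology_map C \<sigma> n ` carrier (homology B n)"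
    then obtain b where b: "b \<in> cycles B n" and W: "W = hclass C n (\<sigma> n b)"
      by (auto simp: homology_\<sigma>_hclass elim!: B.homologyE)
    have "?D W = hclass G (n - 1) \<zero>\<^bsub>chains G (n - 1)\<^esub>"
      unfolding W using b \<sigma>_cycle[OF b] by (intro boundary_hclass) (simp_all add: cycles_def)
    then show "W \<in> a_kernel (homology C n) (homology G (n - 1)) ?D"
      using \<sigma>_cycle[OF b] by (simp add: a_kernel_def' W C.hclass_closed G.homology_zero)
  next
    fix W assume "W \<in> a_kernel (homology C n) (homology G (n - 1)) ?D"
    then have "W \<in> carrier (homology C n)" and ker: "?D W = \<zero>\<^bsub>homology G (n - 1)\<^esub>"
      by (auto simp: a_kernel_def')
    then obtain c where c: "c \<in> cycles C n" and W: "W = hclass C n c" by (auto elim: C.homologyE)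
    from c obtain b g where b [simp]: "b \<in> carrier (chains B n)" and cb: "c = \<sigma> n b"
      and g: "g \<in> cycles G (n - 1)"
      and eq: "dpos B n b = \<kappa> (n - 1) g \<oplus>\<^bsub>?B\<^esub> dneg B n b" by (rule cycle_liftE)
    have "?D W = hclass G (n - 1) g"
      unfolding W cb using c g eq by (intro boundary_hclass) (simp_all add: cb G.cycle_closed)
    then have "(\<zero>\<^bsub>chains G (n - 1)\<^esub>, g) \<in> homology_rel G (n - 1)"
      using ker g G.hclass_eq_iff[OF G.zero_cycle g] by (simp add: G.homology_zero)
    then obtain w where w [simp]: "w \<in> carrier (chains G n)"
      and wg: "dpos G n w \<oplus>\<^bsub>chains G (n - 1)\<^esub> g = \<zero>\<^bsub>chains G (n - 1)\<^esub>"
      using g G.zero_cycle by (auto simp: G.module_homologous_iff)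
    \<comment> \<open>\<open>w\<close> is chosen with \<open>d w + g = 0\<close>, so that the term \<open>\<kappa> g\<close> in \<open>\<partial>\<^sup>+ b\<close> is cancelled\<close>
    let ?b = "\<kappa> n w \<oplus>\<^bsub>chains B n\<^esub> b"
    have "dpos B n ?b = dneg B n (\<kappa> n w) \<oplus>\<^bsub>?B\<^esub>
        \<kappa> (n - 1) (dpos G n w \<oplus>\<^bsub>chains G (n - 1)\<^esub> g) \<oplus>\<^bsub>?B\<^esub> dneg B n b"
      using g by (simp add: eq \<kappa>_diff B.ch.a_assoc G.cycle_closed)
    then have "?b \<in> cycles B n" by (simp add: wg cycles_def)
    then show "W \<in> homology_map C \<sigma> n ` carrier (homology B n)"
      by (intro image_eqI[of _ _ "hclass B n ?b"])
        (simp_all add: W cb homology_\<sigma>_hclass B.hclass_closed)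
  qed
  then show ?thesis by (simp add: exact_at_def boundary_hom homology_\<sigma>_hom)
qed

lemma \<kappa>_null_homologous_iff:
  assumes g: "g \<in> cycles G (n - 1)"
  shows "homology_map B \<kappa> (n - 1) (hclass G (n - 1) g) = \<zero>\<^bsub>homology B (n - 1)\<^esub> \<longleftrightarrow>
    (\<exists>u v. lifts n u v \<zero>\<^bsub>chains B (n - 1)\<^esub> g)"
proof -
  let ?B = "chains B (n - 1)"
  have [simp]: "g \<in> carrier (chains G (n - 1))" using g by (rule G.cycle_closed)
  have "homology_map B \<kappa> (n - 1) (hclass G (n - 1) g) = \<zero>\<^bsub>homology B (n - 1)\<^esub> \<longleftrightarrow>
      (\<zero>\<^bsub>?B\<^esub>, \<kappa> (n - 1) g) \<in> homology_rel B (n - 1)"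
    using g B.hclass_eq_iff[OF B.zero_cycle \<kappa>_cycle[OF g]]
    by (auto simp: homology_\<kappa>_hclass B.homology_zero)
  also have "\<dots> \<longleftrightarrow> (\<exists>u\<in>carrier (chains B n). \<exists>v\<in>carrier (chains B n).
      dpos B n u \<oplus>\<^bsub>?B\<^esub> dneg B n v = \<kappa> (n - 1) g \<oplus>\<^bsub>?B\<^esub> (dpos B n v \<oplus>\<^bsub>?B\<^esub> dneg B n u))"
    using B.zero_cycle \<kappa>_cycle[OF g] by (simp add: homology_rel_def B.ch.a_assoc)
  also have "\<dots> \<longleftrightarrow> (\<exists>u v. lifts n u v \<zero>\<^bsub>?B\<^esub> g)"
  proof -
    have "lifts n u v \<zero>\<^bsub>?B\<^esub> g \<longleftrightarrow> u \<in> carrier (chains B n) \<and> v \<in> carrier (chains B n) \<and>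
        dpos B n u \<oplus>\<^bsub>?B\<^esub> dneg B n v = \<kappa> (n - 1) g \<oplus>\<^bsub>?B\<^esub> (dpos B n v \<oplus>\<^bsub>?B\<^esub> dneg B n u)"
      for u v
      by (simp add: lifts_def cong: conj_cong)
    then show ?thesis by blast
  qed
  finally show ?thesis .
qed

text \<open>
  Compared with the image of the completed connecting homomorphism, the kernel consists of the
  lifts with trivial auxiliary summand.
\<close>

lemma kernel_homology_\<kappa>:
  "a_kernel (homology G (n - 1)) (homology B (n - 1)) (homology_map B \<kappa> (n - 1))
    = {hclass G (n - 1) g | g. \<exists>u v. lifts n u v \<zero>\<^bsub>chains B (n - 1)\<^esub> g}"
proof (intro subset_antisym subsetI)
  fix W assume "W \<in> a_kernel (homology G (n - 1)) (homology B (n - 1)) (homology_map B \<kappa> (n - 1))"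
  then have "W \<in> carrier (homology G (n - 1))"
    and ker: "homology_map B \<kappa> (n - 1) W = \<zero>\<^bsub>homology B (n - 1)\<^esub>"
    by (auto simp: a_kernel_def')
  then obtain g where g: "g \<in> cycles G (n - 1)" "W = hclass G (n - 1) g" by (auto elim: G.homologyE)
  with ker show "W \<in> {hclass G (n - 1) g | g. \<exists>u v. lifts n u v \<zero>\<^bsub>chains B (n - 1)\<^esub> g}"
    using \<kappa>_null_homologous_iff[OF g(1)] by blast
next
  fix W assume "W \<in> {hclass G (n - 1) g | g. \<exists>u v. lifts n u v \<zero>\<^bsub>chains B (n - 1)\<^esub> g}"
  then obtain g u v where W: "W = hclass G (n - 1) g" and l: "lifts n u v \<zero>\<^bsub>chains B (n - 1)\<^esub> g"
    by blast
  from l have g: "g \<in> cycles G (n - 1)" by (rule lifts_cycle)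
  then show "W \<in> a_kernel (homology G (n - 1)) (homology B (n - 1)) (homology_map B \<kappa> (n - 1))"
    using \<kappa>_null_homologous_iff[OF g] l by (auto simp: a_kernel_def' W G.hclass_closed)
qed

lemma boundary_image_subset:
  "boundary G B C \<kappa> \<sigma> n ` carrier (homology C n)
    \<subseteq> a_kernel (homology G (n - 1)) (homology B (n - 1)) (homology_map B \<kappa> (n - 1))"
proof
  fix W assume "W \<in> boundary G B C \<kappa> \<sigma> n ` carrier (homology C n)"
  then obtain c where c: "c \<in> cycles C n" and W: "W = boundary G B C \<kappa> \<sigma> n (hclass C n c)"
    by (auto elim: C.homologyE)
  from c obtain b g where b: "b \<in> carrier (chains B n)" "c = \<sigma> n b" and g: "g \<in> cycles G (n - 1)"
    and eq: "dpos B n b = \<kappa> (n - 1) g \<oplus>\<^bsub>chains B (n - 1)\<^esub> dneg B n b" by (rule cycle_liftE)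
  have "W = hclass G (n - 1) g"
    unfolding W b(2) using b c g eq by (intro boundary_hclass) (simp_all add: G.cycle_closed)
  moreover have "lifts n b \<zero>\<^bsub>chains B n\<^esub> \<zero>\<^bsub>chains B (n - 1)\<^esub> g"
    using b g by (simp add: lifts_def eq G.cycle_closed)
  ultimately show "W \<in> a_kernel (homology G (n - 1)) (homology B (n - 1)) (homology_map B \<kappa> (n - 1))"
    unfolding kernel_homology_\<kappa> by blast
qed

lemma kernel_subset_completed_image:
  "a_kernel (homology G (n - 1)) (homology B (n - 1)) (homology_map B \<kappa> (n - 1))
    \<subseteq> completed_connecting G B C \<kappa> \<sigma> n ` carrier (homology (completion_complex C) n)"
  unfolding kernel_homology_\<kappa> completed_connecting_image by blast

text \<open>
  Cancellation in \<open>C\<close> passes to \<open>B\<close>: if \<open>s + z = t + z\<close>, then \<open>s\<close> and \<open>t\<close> lie over the same element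
  of \<open>C\<close>, and freeness of the action forces \<open>s = t\<close>.  Every auxiliary summand can then be
  removed.
\<close>

lemma completed_image_subset_kernel:
  assumes "\<forall>m. cancellative (chains C m)"
  shows "completed_connecting G B C \<kappa> \<sigma> n ` carrier (homology (completion_complex C) n)
    \<subseteq> a_kernel (homology G (n - 1)) (homology B (n - 1)) (homology_map B \<kappa> (n - 1))"
proof -
  let ?B = "chains B (n - 1)" and ?C = "chains C (n - 1)"
  have "lifts n u v \<zero>\<^bsub>?B\<^esub> g" if l: "lifts n u v z g" for u v z g
  proof -
    let ?s = "dpos B n u \<oplus>\<^bsub>?B\<^esub> dneg B n v"
    let ?t = "\<kappa> (n - 1) g \<oplus>\<^bsub>?B\<^esub> (dpos B n v \<oplus>\<^bsub>?B\<^esub> dneg B n u)"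
    have [simp]: "u \<in> carrier (chains B n)" "v \<in> carrier (chains B n)"
        "z \<in> carrier ?B" "g \<in> carrier (chains G (n - 1))"
      and st: "?s \<oplus>\<^bsub>?B\<^esub> z = ?t \<oplus>\<^bsub>?B\<^esub> z"
      using l by (simp_all add: lifts_def)
    have "\<sigma> (n - 1) z \<oplus>\<^bsub>?C\<^esub> \<sigma> (n - 1) ?s = \<sigma> (n - 1) z \<oplus>\<^bsub>?C\<^esub> \<sigma> (n - 1) ?t"
      using arg_cong[OF st, of "\<sigma> (n - 1)"]
      by (simp add: C.ch.a_comm[of "\<sigma> (n - 1) z"])
    then have "\<sigma> (n - 1) ?s = \<sigma> (n - 1) ?t"
      by (rule \<sigma>.cancel[OF spec[OF assms], rotated 3]) simp_all
    then obtain h where h [simp]: "h \<in> carrier (chains G (n - 1))"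
      and s: "?s = \<kappa> (n - 1) h \<oplus>\<^bsub>?B\<^esub> ?t"
      by (rule fibre_transitive[rotated 2]) simp_all
    have "\<kappa> (n - 1) h \<oplus>\<^bsub>?B\<^esub> (?t \<oplus>\<^bsub>?B\<^esub> z)
        = \<kappa> (n - 1) \<zero>\<^bsub>chains G (n - 1)\<^esub> \<oplus>\<^bsub>?B\<^esub> (?t \<oplus>\<^bsub>?B\<^esub> z)"
      using st unfolding s by (simp add: B.ch.a_assoc)
    then have "h = \<zero>\<^bsub>chains G (n - 1)\<^esub>"
      by (rule fibre_free[rotated 3]) simp_all
    with s show ?thesis by (simp add: lifts_def)
  qed
  then show ?thesis unfolding kernel_homology_\<kappa> completed_connecting_image by blast
qed

lemma exact_at_G_iff:
  "exact_at R (homology C n) (boundary G B C \<kappa> \<sigma> n) (homology G (n - 1))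
      (homology_map B \<kappa> (n - 1)) (homology B (n - 1)) \<longleftrightarrow>
    a_kernel (homology G (n - 1)) (homology B (n - 1)) (homology_map B \<kappa> (n - 1))
      \<subseteq> boundary G B C \<kappa> \<sigma> n ` carrier (homology C n)"
  using boundary_image_subset[of n] by (auto simp: exact_at_def boundary_hom homology_\<kappa>_hom)

end

section \<open>The long homology sequence\<close>

theorem theorem2p5:
  fixes R :: "('r, 'm) ring_scheme"
    and G\<^sub>0 :: "int \<Rightarrow> ('r, 'g) module" and d :: "int \<Rightarrow> 'g \<Rightarrow> 'g"
    and G :: "('r, 'g) pm_complex" and B :: "('r, 'b) pm_complex" and C :: "('r, 'c) pm_complex"
    and \<kappa> :: "int \<Rightarrow> 'g \<Rightarrow> 'b" and \<sigma> :: "int \<Rightarrow> 'b \<Rightarrow> 'c"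
  assumes "semiring R"
    and "ordinary_chain_complex R G\<^sub>0 d"
    and "\<forall>n. abelian_group (G\<^sub>0 n)"
    and "G = ordinary G\<^sub>0 d"
    and "schreier_short_exact R G B C \<kappa> \<sigma>"
    and "pm_morphism R B C \<sigma> \<or> (\<forall>n. cancellative (chains C n))"
  shows "\<forall>n.
      homology_map_defined G B \<kappa> n \<and>
      homology_map_defined B C \<sigma> n \<and>
      exact_at R (homology G n) (homology_map B \<kappa> n) (homology B n)
        (homology_map C \<sigma> n) (homology C n) \<and>
      exact_at R (homology B n) (homology_map C \<sigma> n) (homology C n)
        (boundary G B C \<kappa> \<sigma> n) (homology G (n - 1)) \<and>
      boundary G B C \<kappa> \<sigma> n ` carrier (homology C n)
        \<subseteq> a_kernel (homology G (n - 1)) (homology B (n - 1)) (homology_map B \<kappa> (n - 1)) \<and>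
      normal_hom R (homology B n) (homology C n) (homology_map C \<sigma> n) \<and>
      (completed_connecting G B C \<kappa> \<sigma> n `
            homology_map (completion_complex C) (complex_unit C) n ` carrier (homology C n)
          = completed_connecting G B C \<kappa> \<sigma> n ` carrier (homology (completion_complex C) n)
        \<longrightarrow> exact_at R (homology C n) (boundary G B C \<kappa> \<sigma> n) (homology G (n - 1))
              (homology_map B \<kappa> (n - 1)) (homology B (n - 1))) \<and>
      ((\<forall>m. cancellative (chains C m)) \<longrightarrow>
        exact_at R (homology C n) (boundary G B C \<kappa> \<sigma> n) (homology G (n - 1))
          (homology_map B \<kappa> (n - 1)) (homology B (n - 1)) \<longrightarrow>
        completed_connecting G B C \<kappa> \<sigma> n `
            homology_map (completion_complex C) (complex_unit C) n ` carrier (homology C n)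
          = completed_connecting G B C \<kappa> \<sigma> n ` carrier (homology (completion_complex C) n))"
proof -
  have complexes: "chain_complex R G" "chain_complex R B" "chain_complex R C"
    and \<kappa>: "chain_morphism R G B \<kappa>" and \<sigma>: "chain_morphism R B C \<sigma>"
    and ext: "schreier_extension R (chains G n) (chains B n) (chains C n) (\<kappa> n) (\<sigma> n)" for n
    using assms(5) by (simp_all add: schreier_short_exact_def)
  interpret schreier_by_modules R G B C \<kappa> \<sigma>
  proof (intro schreier_by_modules.intro module_complex.intro module_complex_axioms.intro
      semimodule_complex.intro semimodule_chain_morphism.intro semimodule_complex_maps.intro
      semimodule_complex_maps_axioms.intro semimodule_chain_morphism_axioms.intro
      strong_chain_morphism.intro strong_chain_morphism_axioms.intro
      schreier_by_modules_axioms.intro complexes \<kappa> \<sigma> ext assms(6))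
    show "abelian_group (chains G n)" "dneg G n x = \<zero>\<^bsub>chains G (n - 1)\<^esub>" for n x
      using assms(3) by (simp_all add: assms(4) ordinary_def)
    show "semimodule_hom R (chains G n) (chains B n) (\<kappa> n)"
      "semimodule_hom R (chains B n) (chains C n) (\<sigma> n)" for n
      using \<kappa> \<sigma> by (simp_all add: chain_morphism_def)
  qed
  show ?thesis
  proof (intro allI conjI impI)
    fix n
    have img: "completed_connecting G B C \<kappa> \<sigma> n `
            homology_map (completion_complex C) (complex_unit C) n ` carrier (homology C n)
        = boundary G B C \<kappa> \<sigma> n ` carrier (homology C n)"
      by (simp add: boundary_def image_comp)
    show "exact_at R (homology C n) (boundary G B C \<kappa> \<sigma> n) (homology G (n - 1))
        (homology_map B \<kappa> (n - 1)) (homology B (n - 1))"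
      if "completed_connecting G B C \<kappa> \<sigma> n `
            homology_map (completion_complex C) (complex_unit C) n ` carrier (homology C n)
          = completed_connecting G B C \<kappa> \<sigma> n ` carrier (homology (completion_complex C) n)"
      using that kernel_subset_completed_image[of n] unfolding img exact_at_G_iff by (simp only:)
    show "completed_connecting G B C \<kappa> \<sigma> n `
            homology_map (completion_complex C) (complex_unit C) n ` carrier (homology C n)
          = completed_connecting G B C \<kappa> \<sigma> n ` carrier (homology (completion_complex C) n)"
      if "\<forall>m. cancellative (chains C m)"
        and "exact_at R (homology C n) (boundary G B C \<kappa> \<sigma> n) (homology G (n - 1))
              (homology_map B \<kappa> (n - 1)) (homology B (n - 1))"
    proof -
      have "boundary G B C \<kappa> \<sigma> n ` carrier (homology C n)
          = a_kernel (homology G (n - 1)) (homology B (n - 1)) (homology_map B \<kappa> (n - 1))"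
        using that(2) by (simp add: exact_at_def)
      with kernel_subset_completed_image[of n] completed_image_subset_kernel[OF that(1), of n]
      show ?thesis unfolding img by (simp only: subset_antisym)
    qed
  qed (rule homology_\<kappa>_defined \<sigma>.homology_map_defined exact_at_B exact_at_C
      boundary_image_subset normal_homology_\<sigma>)+
qed

end
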